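(* Let $\mathcal{Z}$ be an abelian category and $\mathcal{A}\subset\mathcal{Z}$ a full abelian subcategory. Then the extension closure $\mathcal{E}x^{\mathcal{Z}}(\mathcal{A})$ of $\mathcal{A}$ in $\mathcal{Z}$ is abelian.
   Context: $\mathcal{A}\subset\mathcal{Z}$ is a full abelian subcategory if it is a strictly full subcategory which is abelian and whose embedding functor $\mathcal{A}\to\mathcal{Z}$ is exact (equivalently, $\mathcal{A}$ is closed in $\mathcal{Z}$ under kernels and cokernels of its morphisms). For strictly full subcategories $\mathcal{A},\mathcal{B}\subset\mathcal{Z}$, $\mathcal{A}\ast\mathcal{B}$ is the full subcategory of objects $C$ fitting into a short exact sequence $0\to A\to C\to B\to0$ with $A\in\mathcal{A}$, $B\in\mathcal{B}$; this operation is associative. $\mathcal{E}x_k^{\mathcal{Z}}(\mathcal{A})=\mathcal{A}\ast\cdots\ast\mathcal{A}$ ($k+1$ factors), and $\mathcal{E}x^{\mathcal{Z}}(\mathcal{A})=\bigcup_{k\geq0}\mathcal{E}x_k^{\mathcal{Z}}(\mathcal{A})$. *)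

theory Defs
  imports "HOL-Algebra.Group"
begin

text \<open>
  Arrows carry their domain and codomain, so hom-sets of different pairs of objects are disjoint.
  \<open>Comp C g f\<close> is the composite ``\<open>g\<close> after \<open>f\<close>''; it is meaningful only if
  \<open>Cod C f = Dom C g\<close>.
\<close>

record ('o, 'm) cat =
  Obj :: "'o set"
  Arr :: "'m set"
  Dom :: "'m \<Rightarrow> 'o"
  Cod :: "'m \<Rightarrow> 'o"
  Id :: "'o \<Rightarrow> 'm"
  Comp :: "'m \<Rightarrow> 'm \<Rightarrow> 'm" (infixl "\<cdot>\<index>" 70)

definition Hom :: "('o, 'm, 'x) cat_scheme \<Rightarrow> 'o \<Rightarrow> 'o \<Rightarrow> 'm set" where
  "Hom C X Y = {f \<in> Arr C. Dom C f = X \<and> Cod C f = Y}"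

locale category =
  fixes C :: "('o, 'm, 'x) cat_scheme" (structure)
  assumes Dom_closed: "f \<in> Arr C \<Longrightarrow> Dom C f \<in> Obj C"
    and Cod_closed: "f \<in> Arr C \<Longrightarrow> Cod C f \<in> Obj C"
    and Id_closed: "X \<in> Obj C \<Longrightarrow> Id C X \<in> Hom C X X"
    and Comp_closed: "f \<in> Hom C X Y \<Longrightarrow> g \<in> Hom C Y W \<Longrightarrow> g \<cdot> f \<in> Hom C X W"
    and Comp_Id_left: "f \<in> Hom C X Y \<Longrightarrow> Id C Y \<cdot> f = f"
    and Comp_Id_right: "f \<in> Hom C X Y \<Longrightarrow> f \<cdot> Id C X = f"
    and Comp_assoc: "f \<in> Hom C X Y \<Longrightarrow> g \<in> Hom C Y W \<Longrightarrow> h \<in> Hom C W V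
          \<Longrightarrow> (h \<cdot> g) \<cdot> f = h \<cdot> (g \<cdot> f)"

definition isomorphic :: "('o, 'm, 'x) cat_scheme \<Rightarrow> 'o \<Rightarrow> 'o \<Rightarrow> bool" where
  "isomorphic C X Y \<longleftrightarrow>
     (\<exists>f \<in> Hom C X Y. \<exists>g \<in> Hom C Y X. g \<cdot>\<^bsub>C\<^esub> f = Id C X \<and> f \<cdot>\<^bsub>C\<^esub> g = Id C Y)"

definition monic :: "('o, 'm, 'x) cat_scheme \<Rightarrow> 'm \<Rightarrow> bool" where
  "monic C f \<longleftrightarrow> f \<in> Arr C \<and>
     (\<forall>W. \<forall>g \<in> Hom C W (Dom C f). \<forall>h \<in> Hom C W (Dom C f).
        f \<cdot>\<^bsub>C\<^esub> g = f \<cdot>\<^bsub>C\<^esub> h \<longrightarrow> g = h)"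

definition epic :: "('o, 'm, 'x) cat_scheme \<Rightarrow> 'm \<Rightarrow> bool" where
  "epic C f \<longleftrightarrow> f \<in> Arr C \<and>
     (\<forall>W. \<forall>g \<in> Hom C (Cod C f) W. \<forall>h \<in> Hom C (Cod C f) W.
        g \<cdot>\<^bsub>C\<^esub> f = h \<cdot>\<^bsub>C\<^esub> f \<longrightarrow> g = h)"

definition null_object :: "('o, 'm, 'x) cat_scheme \<Rightarrow> 'o \<Rightarrow> bool" where
  "null_object C N \<longleftrightarrow> N \<in> Obj C \<and>
     (\<forall>X \<in> Obj C. (\<exists>!f. f \<in> Hom C N X) \<and> (\<exists>!f. f \<in> Hom C X N))"

record ('o, 'm) ab_cat = "('o, 'm) cat" +
  Add :: "'m \<Rightarrow> 'm \<Rightarrow> 'm"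
  Zero :: "'o \<Rightarrow> 'o \<Rightarrow> 'm"

definition hom_group :: "('o, 'm, 'x) ab_cat_scheme \<Rightarrow> 'o \<Rightarrow> 'o \<Rightarrow> 'm monoid" where
  "hom_group C X Y = \<lparr>carrier = Hom C X Y, mult = Add C, one = Zero C X Y\<rparr>"

locale preadditive_category = category C
  for C :: "('o, 'm, 'x) ab_cat_scheme" (structure) +
  assumes hom_comm_group: "X \<in> Obj C \<Longrightarrow> Y \<in> Obj C \<Longrightarrow> comm_group (hom_group C X Y)"
    and Comp_Add_left: "f \<in> Hom C X Y \<Longrightarrow> g \<in> Hom C Y W \<Longrightarrow> h \<in> Hom C Y W
          \<Longrightarrow> Add C g h \<cdot> f = Add C (g \<cdot> f) (h \<cdot> f)"
    and Comp_Add_right: "f \<in> Hom C X Y \<Longrightarrow> g \<in> Hom C X Y \<Longrightarrow> h \<in> Hom C Y W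
          \<Longrightarrow> h \<cdot> Add C f g = Add C (h \<cdot> f) (h \<cdot> g)"

definition is_biproduct ::
  "('o, 'm, 'x) ab_cat_scheme \<Rightarrow> 'o \<Rightarrow> 'o \<Rightarrow> 'o \<Rightarrow> 'm \<Rightarrow> 'm \<Rightarrow> 'm \<Rightarrow> 'm \<Rightarrow> bool" where
  "is_biproduct C X Y B i j p q \<longleftrightarrow>
     B \<in> Obj C \<and>
     i \<in> Hom C X B \<and> j \<in> Hom C Y B \<and> p \<in> Hom C B X \<and> q \<in> Hom C B Y \<and>
     p \<cdot>\<^bsub>C\<^esub> i = Id C X \<and> q \<cdot>\<^bsub>C\<^esub> j = Id C Y \<and>
     Add C (i \<cdot>\<^bsub>C\<^esub> p) (j \<cdot>\<^bsub>C\<^esub> q) = Id C B"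

definition is_kernel :: "('o, 'm, 'x) ab_cat_scheme \<Rightarrow> 'm \<Rightarrow> 'm \<Rightarrow> bool" where
  "is_kernel C k f \<longleftrightarrow>
     k \<in> Arr C \<and> f \<in> Arr C \<and> Cod C k = Dom C f \<and>
     f \<cdot>\<^bsub>C\<^esub> k = Zero C (Dom C k) (Cod C f) \<and>
     (\<forall>W. \<forall>h \<in> Hom C W (Dom C f). f \<cdot>\<^bsub>C\<^esub> h = Zero C W (Cod C f) \<longrightarrow>
        (\<exists>!u. u \<in> Hom C W (Dom C k) \<and> k \<cdot>\<^bsub>C\<^esub> u = h))"

definition is_cokernel :: "('o, 'm, 'x) ab_cat_scheme \<Rightarrow> 'm \<Rightarrow> 'm \<Rightarrow> bool" where
  "is_cokernel C c f \<longleftrightarrow>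
     c \<in> Arr C \<and> f \<in> Arr C \<and> Dom C c = Cod C f \<and>
     c \<cdot>\<^bsub>C\<^esub> f = Zero C (Dom C f) (Cod C c) \<and>
     (\<forall>W. \<forall>h \<in> Hom C (Cod C f) W. h \<cdot>\<^bsub>C\<^esub> f = Zero C (Dom C f) W \<longrightarrow>
        (\<exists>!u. u \<in> Hom C (Cod C c) W \<and> u \<cdot>\<^bsub>C\<^esub> c = h))"

text \<open>Mac Lane, \<^emph>\<open>Categories for the Working Mathematician\<close>, VIII.2--3.\<close>

locale additive_category = preadditive_category +
  assumes ex_null_object: "\<exists>N. null_object C N"
    and ex_biproduct: "X \<in> Obj C \<Longrightarrow> Y \<in> Obj C \<Longrightarrow> \<exists>B i j p q. is_biproduct C X Y B i j p q"

locale abelian_category = additive_category +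
  assumes ex_kernel: "f \<in> Arr C \<Longrightarrow> \<exists>k. is_kernel C k f"
    and ex_cokernel: "f \<in> Arr C \<Longrightarrow> \<exists>c. is_cokernel C c f"
    and monic_is_kernel: "monic C m \<Longrightarrow> \<exists>f. is_kernel C m f"
    and epic_is_cokernel: "epic C e \<Longrightarrow> \<exists>f. is_cokernel C e f"

definition short_exact :: "('o, 'm, 'x) ab_cat_scheme \<Rightarrow> 'm \<Rightarrow> 'm \<Rightarrow> bool" where
  "short_exact C f g \<longleftrightarrow> is_kernel C f g \<and> is_cokernel C g f"

definition full_subcat :: "('o, 'm, 'x) cat_scheme \<Rightarrow> 'o set \<Rightarrow> ('o, 'm, 'x) cat_scheme" where
  "full_subcat C S = C\<lparr>Obj := S, Arr := {f \<in> Arr C. Dom C f \<in> S \<and> Cod C f \<in> S}\<rparr>"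

text \<open>A full subcategory is identified with its set of objects; strict means closed under
  isomorphism.\<close>

definition strictly_full :: "('o, 'm, 'x) cat_scheme \<Rightarrow> 'o set \<Rightarrow> bool" where
  "strictly_full C S \<longleftrightarrow> S \<subseteq> Obj C \<and> (\<forall>X \<in> S. \<forall>Y \<in> Obj C. isomorphic C X Y \<longrightarrow> Y \<in> S)"

locale additive_functor = source: preadditive_category C + target: preadditive_category D
  for C :: "('o, 'm, 'x) ab_cat_scheme" and D :: "('p, 'n, 'y) ab_cat_scheme"
    and Fo :: "'o \<Rightarrow> 'p" and Fa :: "'m \<Rightarrow> 'n" +
  assumes obj_map: "X \<in> Obj C \<Longrightarrow> Fo X \<in> Obj D"
    and arr_map: "f \<in> Hom C X Y \<Longrightarrow> Fa f \<in> Hom D (Fo X) (Fo Y)"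
    and map_Id: "X \<in> Obj C \<Longrightarrow> Fa (Id C X) = Id D (Fo X)"
    and map_Comp: "f \<in> Hom C X Y \<Longrightarrow> g \<in> Hom C Y W \<Longrightarrow> Fa (g \<cdot>\<^bsub>C\<^esub> f) = Fa g \<cdot>\<^bsub>D\<^esub> Fa f"
    and map_Add: "f \<in> Hom C X Y \<Longrightarrow> g \<in> Hom C X Y \<Longrightarrow> Fa (Add C f g) = Add D (Fa f) (Fa g)"

locale exact_functor = additive_functor +
  assumes map_short_exact: "short_exact C f g \<Longrightarrow> short_exact D (Fa f) (Fa g)"

text \<open>The hom-groups of the subcategory are those of \<open>Z\<close>. This is no restriction: the addition of
  an additive category is determined by the underlying category.\<close>

definition full_abelian_subcategory :: "('o, 'm, 'x) ab_cat_scheme \<Rightarrow> 'o set \<Rightarrow> bool" where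
  "full_abelian_subcategory Z A \<longleftrightarrow>
     strictly_full Z A \<and>
     abelian_category (full_subcat Z A) \<and>
     exact_functor (full_subcat Z A) Z (\<lambda>X. X) (\<lambda>f. f)"

definition ext_product :: "('o, 'm, 'x) ab_cat_scheme \<Rightarrow> 'o set \<Rightarrow> 'o set \<Rightarrow> 'o set" where
  "ext_product Z A B =
     {X \<in> Obj Z. \<exists>f g. short_exact Z f g \<and> Dom Z f \<in> A \<and> Cod Z f = X \<and> Cod Z g \<in> B}"

text \<open>\<open>Ex_iter Z A k\<close> has \<open>k + 1\<close> factors \<open>A\<close>, bracketed to the left.\<close>

primrec Ex_iter :: "('o, 'm, 'x) ab_cat_scheme \<Rightarrow> 'o set \<Rightarrow> nat \<Rightarrow> 'o set" where
  "Ex_iter Z A 0 = A"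
| "Ex_iter Z A (Suc k) = ext_product Z (Ex_iter Z A k) A"

definition Ex_closure :: "('o, 'm, 'x) ab_cat_scheme \<Rightarrow> 'o set \<Rightarrow> 'o set" where
  "Ex_closure Z A = (\<Union>k. Ex_iter Z A k)"

end

theory Submission
  imports Defs
begin

text \<open>
  Write \<open>E\<^sub>k\<close> for the objects filtered by \<open>k + 1\<close> objects of \<open>A\<close>. The heart of the matter is that an
  arrow \<open>f\<close> from \<open>X \<in> E\<^sub>k\<close> to \<open>Y \<in> E\<^sub>n\<close> has its kernel in \<open>E\<^sub>k\<close> and its cokernel in \<open>E\<^sub>n\<close>; no
  connecting homomorphism between subquotients has to be analysed, because the layers can be peeled
  off in an order that makes it vanish.

  If \<open>Y\<close> lies in \<open>A\<close>, let \<open>X''\<close> be the top layer of \<open>X\<close> and \<open>X'\<close> the rest. By induction the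
  restriction of \<open>f\<close> to \<open>X'\<close> has its kernel in \<open>E\<^sub>k\<^sub>-\<^sub>1\<close> and its cokernel \<open>Y'\<close> in \<open>A\<close>, and \<open>f\<close> induces an
  arrow \<open>g\<close> from \<open>X''\<close> to \<open>Y'\<close> inside \<open>A\<close>. The cokernel of \<open>f\<close> is that of \<open>g\<close>. The kernel of \<open>f\<close> is an
  extension of the kernel of \<open>g\<close> by the kernel of the restriction: the obstruction to lifting
  from the kernel of \<open>g\<close> lies in the cokernel of \<open>X'\<close> mapping onto its own image
  (\<open>kernel_cokernel_into_A\<close>, from \<open>cokernel_on_extension\<close> and \<open>kernel_on_extension\<close>). For general \<open>Y\<close>
  with top layer \<open>Y''\<close> and rest \<open>Y'\<close>, the composite of \<open>f\<close> with the projection to \<open>Y''\<close> is of the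
  kind just treated, and \<open>f\<close> restricted to its kernel lands in \<open>Y'\<close>, so that induction on
  \<open>n\<close> applies. The two facts about extensions used here are the duals of the previous two
  (\<open>kernel_cokernel_Ex_iter\<close>).

  The extension closure is moreover closed under extensions, in particular under biproducts
  (\<open>Ex_iter_extension\<close>). A full subcategory of an abelian category that contains a null object and is
  closed under biproducts, kernels and cokernels is abelian (\<open>abelian_full_subcat\<close>).

  Diagrams are chased with generalized elements: since epic arrows are stable under pullback, an
  element of a quotient lifts after passing to an epic cover of its domain (\<open>epic_local_lift\<close>,
  \<open>exact_local_lift\<close>). Passing to the opposite category halves the work.
\<close>

section \<open>Composition and addition of arrows\<close>

context category
begin

lemma in_HomD:
  assumes "f \<in> Hom C X Y"
  shows "f \<in> Arr C" "Dom C f = X" "Cod C f = Y" "X \<in> Obj C" "Y \<in> Obj C"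
  using assms Dom_closed Cod_closed by (auto simp: Hom_def)

lemma in_Hom: "f \<in> Arr C \<Longrightarrow> f \<in> Hom C (Dom C f) (Cod C f)"
  by (simp add: Hom_def)

lemma Comp_simps [simp]:
  assumes "f \<in> Arr C" "g \<in> Arr C" "Cod C f = Dom C g"
  shows "g \<cdot> f \<in> Arr C" "Dom C (g \<cdot> f) = Dom C f" "Cod C (g \<cdot> f) = Cod C g"
  using Comp_closed[of f "Dom C f" "Dom C g" g "Cod C g"] assms by (auto simp: Hom_def)

lemma assoc:
  assumes "f \<in> Arr C" "g \<in> Arr C" "h \<in> Arr C" "Cod C f = Dom C g" "Cod C g = Dom C h"
  shows "(h \<cdot> g) \<cdot> f = h \<cdot> (g \<cdot> f)"
  using Comp_assoc[of f "Dom C f" "Dom C g" g "Dom C h" h "Cod C h"] assms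
  by (auto simp: Hom_def)

text \<open>With composites associated to the right, an equation \<open>g \<cdot> f = q\<close> no longer matches inside
  \<open>g \<cdot> (f \<cdot> x)\<close>; this variant does, so that commuting squares can be used as rewrite rules.\<close>

lemma reassoc:
  assumes "g \<cdot> f = q" "f \<in> Arr C" "g \<in> Arr C" "Cod C f = Dom C g" "x \<in> Arr C" "Cod C x = Dom C f"
  shows "g \<cdot> (f \<cdot> x) = q \<cdot> x"
  using assms assoc by metis

lemma Id_simps [simp]:
  assumes "X \<in> Obj C"
  shows "Id C X \<in> Arr C" "Dom C (Id C X) = X" "Cod C (Id C X) = X"
  using Id_closed[OF assms] by (auto simp: Hom_def)

lemma Comp_Id [simp]:
  assumes "f \<in> Arr C"
  shows "Cod C f = Y \<Longrightarrow> Id C Y \<cdot> f = f" "Dom C f = X \<Longrightarrow> f \<cdot> Id C X = f"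
  using Comp_Id_left[OF in_Hom] Comp_Id_right[OF in_Hom] assms by auto

lemma monic_cancel:
  assumes "monic C m" "m \<cdot> g = m \<cdot> h" "g \<in> Hom C W (Dom C m)" "h \<in> Hom C W (Dom C m)"
  shows "g = h"
  using assms unfolding monic_def by blast

lemma epic_cancel:
  assumes "epic C e" "g \<cdot> e = h \<cdot> e" "g \<in> Hom C (Cod C e) W" "h \<in> Hom C (Cod C e) W"
  shows "g = h"
  using assms unfolding epic_def by blast

lemma epic_Comp:
  assumes "epic C e" "epic C d" "Cod C e = Dom C d"
  shows "epic C (d \<cdot> e)"
  using assms unfolding epic_def by (auto simp: Hom_def assoc[symmetric])

lemma epic_of_Comp:
  assumes de: "epic C (d \<cdot> e)" and e: "e \<in> Arr C" "d \<in> Arr C" "Cod C e = Dom C d"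
  shows "epic C d"
  unfolding epic_def
proof (intro conjI allI ballI impI)
  fix W g h assume g: "g \<in> Hom C (Cod C d) W" and h: "h \<in> Hom C (Cod C d) W" and "g \<cdot> d = h \<cdot> d"
  then have "g \<cdot> (d \<cdot> e) = h \<cdot> (d \<cdot> e)"
    using e in_HomD[OF g] in_HomD[OF h] assoc[of e d g] assoc[of e d h] by simp
  then show "g = h" using epic_cancel[OF de] g h e by simp
qed (rule e)

lemma monic_Comp:
  assumes "monic C m" "monic C n" "Cod C m = Dom C n"
  shows "monic C (n \<cdot> m)"
  using assms unfolding monic_def by (auto simp: Hom_def assoc)

end

context preadditive_category
begin

lemma Zero_closed: "X \<in> Obj C \<Longrightarrow> Y \<in> Obj C \<Longrightarrow> Zero C X Y \<in> Hom C X Y"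
  using monoid.one_closed[OF comm_group.axioms(1)[THEN comm_monoid.axioms(1), OF hom_comm_group]]
  by (simp add: hom_group_def)

lemma Zero_simps [simp]:
  assumes "X \<in> Obj C" "Y \<in> Obj C"
  shows "Zero C X Y \<in> Arr C" "Dom C (Zero C X Y) = X" "Cod C (Zero C X Y) = Y"
  using Zero_closed[OF assms] by (auto simp: Hom_def)

lemma Add_Zero:
  assumes "f \<in> Hom C X Y"
  shows "Add C f (Zero C X Y) = f" "Add C (Zero C X Y) f = f"
proof -
  interpret G: comm_group "hom_group C X Y"
    by (rule hom_comm_group[OF in_HomD(4,5)[OF assms]])
  show "Add C f (Zero C X Y) = f" "Add C (Zero C X Y) f = f"
    using G.r_one G.l_one assms by (simp_all add: hom_group_def)
qed

lemma ex_difference: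
  assumes "f \<in> Hom C X Y" "g \<in> Hom C X Y"
  obtains d where "d \<in> Hom C X Y" "Add C d g = f"
proof -
  interpret G: comm_group "hom_group C X Y"
    by (rule hom_comm_group[OF in_HomD(4,5)[OF assms(1)]])
  have "f \<in> carrier (hom_group C X Y)" "g \<in> carrier (hom_group C X Y)"
    using assms by (simp_all add: hom_group_def)
  then have "f \<otimes>\<^bsub>hom_group C X Y\<^esub> inv\<^bsub>hom_group C X Y\<^esub> g \<in> carrier (hom_group C X Y)"
    and "(f \<otimes>\<^bsub>hom_group C X Y\<^esub> inv\<^bsub>hom_group C X Y\<^esub> g) \<otimes>\<^bsub>hom_group C X Y\<^esub> g = f"
    by (simp_all add: G.m_assoc)
  then show thesis using that by (simp add: hom_group_def)
qed

lemma Add_right_cancel: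
  assumes "f \<in> Hom C X Y" "g \<in> Hom C X Y" "h \<in> Hom C X Y"
    and "Add C f h = Add C g h"
  shows "f = g"
proof -
  interpret G: comm_group "hom_group C X Y"
    by (rule hom_comm_group[OF in_HomD(4,5)[OF assms(1)]])
  show ?thesis using G.right_cancel[of h f g] assms by (simp add: hom_group_def)
qed

lemma Add_commute:
  assumes "f \<in> Hom C X Y" "g \<in> Hom C X Y"
  shows "Add C f g = Add C g f"
proof -
  interpret G: comm_group "hom_group C X Y"
    by (rule hom_comm_group[OF in_HomD(4,5)[OF assms(1)]])
  show ?thesis using G.m_comm[of f g] assms by (simp add: hom_group_def)
qed

lemma Zero_if_Add_eq:
  assumes "f \<in> Hom C X Y" "g \<in> Hom C X Y" "Add C f g = g"
  shows "f = Zero C X Y"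
  using Add_right_cancel[of f X Y "Zero C X Y" g] Add_Zero(2)[of g X Y] assms
    Zero_closed[of X Y] in_HomD(4,5)[OF assms(1)] by simp

lemma Zero_Comp [simp]:
  assumes "f \<in> Arr C" "Cod C f = Y" "W \<in> Obj C"
  shows "Zero C Y W \<cdot> f = Zero C (Dom C f) W"
proof -
  have f: "f \<in> Hom C (Dom C f) Y" using assms by (simp add: Hom_def)
  then have 0: "Zero C Y W \<in> Hom C Y W" using assms(3) Zero_closed in_HomD(5) by blast
  have "Add C (Zero C Y W \<cdot> f) (Zero C Y W \<cdot> f) = Zero C Y W \<cdot> f"
    using Comp_Add_left[OF f 0 0] Add_Zero[OF 0] by simp
  then show ?thesis using Zero_if_Add_eq Comp_closed[OF f 0] by blast
qed

lemma Comp_Zero [simp]: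
  assumes "f \<in> Arr C" "Dom C f = Y" "W \<in> Obj C"
  shows "f \<cdot> Zero C W Y = Zero C W (Cod C f)"
proof -
  have f: "f \<in> Hom C Y (Cod C f)" using assms by (simp add: Hom_def)
  then have 0: "Zero C W Y \<in> Hom C W Y" using assms(3) Zero_closed in_HomD(4) by blast
  have "Add C (f \<cdot> Zero C W Y) (f \<cdot> Zero C W Y) = f \<cdot> Zero C W Y"
    using Comp_Add_right[OF 0 0 f] Add_Zero[OF 0] by simp
  then show ?thesis using Zero_if_Add_eq Comp_closed[OF 0 f] by blast
qed

lemma monicI:
  assumes f: "f \<in> Hom C X Y"
    and zero: "\<And>W g. g \<in> Hom C W X \<Longrightarrow> f \<cdot> g = Zero C W Y \<Longrightarrow> g = Zero C W X"
  shows "monic C f"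
  unfolding monic_def
proof (intro conjI allI ballI impI)
  show "f \<in> Arr C" by (rule in_HomD(1)[OF f])
  fix W g h assume gh: "g \<in> Hom C W (Dom C f)" "h \<in> Hom C W (Dom C f)" and eq: "f \<cdot> g = f \<cdot> h"
  have gh': "g \<in> Hom C W X" "h \<in> Hom C W X" using gh in_HomD[OF f] by simp_all
  obtain d where d: "d \<in> Hom C W X" "Add C d h = g" using ex_difference gh' by blast
  have "Add C (f \<cdot> d) (f \<cdot> h) = f \<cdot> h" using Comp_Add_right[OF d(1) gh'(2) f] d(2) eq by simp
  then have "f \<cdot> d = Zero C W Y" using Zero_if_Add_eq Comp_closed[OF d(1) f] Comp_closed[OF gh'(2) f] by blast
  then have "d = Zero C W X" by (rule zero[OF d(1)])
  then show "g = h" using d(2) Add_Zero(2)[OF gh'(2)] by simp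
qed

lemma monic_zero:
  assumes "monic C f" "f \<in> Hom C X Y" "g \<in> Hom C W X" "f \<cdot> g = Zero C W Y"
  shows "g = Zero C W X"
proof (rule monic_cancel[OF assms(1)])
  show "f \<cdot> g = f \<cdot> Zero C W X"
    using assms(2-4) in_HomD[OF assms(2)] in_HomD[OF assms(3)] by simp
  show "g \<in> Hom C W (Dom C f)" "Zero C W X \<in> Hom C W (Dom C f)"
    using in_HomD[OF assms(2)] in_HomD[OF assms(3)] assms(3) Zero_closed by simp_all
qed

text \<open>The definition asks the lift to be unique, which amounts to the kernel being monic; the
  arguments below use the lift and the cancellation separately.\<close>

lemma kernelD:
  assumes "is_kernel C k f" "f \<in> Hom C X Y"
  shows "k \<in> Hom C (Dom C k) X" "f \<cdot> k = Zero C (Dom C k) Y" "monic C k"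
    and "\<And>W h. h \<in> Hom C W X \<Longrightarrow> f \<cdot> h = Zero C W Y \<Longrightarrow> \<exists>u \<in> Hom C W (Dom C k). k \<cdot> u = h"
proof -
  show k: "k \<in> Hom C (Dom C k) X" and fk: "f \<cdot> k = Zero C (Dom C k) Y"
    using assms by (simp_all add: is_kernel_def Hom_def)
  have ex1: "\<exists>!u. u \<in> Hom C W (Dom C k) \<and> k \<cdot> u = h"
    if "h \<in> Hom C W X" "f \<cdot> h = Zero C W Y" for W h
    using assms(1) that in_HomD(2,3)[OF assms(2)] unfolding is_kernel_def by simp
  then show "\<And>W h. h \<in> Hom C W X \<Longrightarrow> f \<cdot> h = Zero C W Y \<Longrightarrow> \<exists>u \<in> Hom C W (Dom C k). k \<cdot> u = h"
    by blast
  show "monic C k"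
  proof (rule monicI[OF k])
    fix W g assume g: "g \<in> Hom C W (Dom C k)" "k \<cdot> g = Zero C W X"
    have "k \<cdot> Zero C W (Dom C k) = Zero C W X" "f \<cdot> Zero C W X = Zero C W Y"
      using in_HomD[OF k] in_HomD[OF g(1)] in_HomD[OF assms(2)] by simp_all
    then show "g = Zero C W (Dom C k)"
      using ex1[of "Zero C W X" W] g Zero_closed in_HomD(4,5)[OF k] in_HomD(4)[OF g(1)] by metis
  qed
qed

lemma kernelI:
  assumes k: "k \<in> Hom C K X" and f: "f \<in> Hom C X Y" and "monic C k" "f \<cdot> k = Zero C K Y"
    and "\<And>W h. h \<in> Hom C W X \<Longrightarrow> f \<cdot> h = Zero C W Y \<Longrightarrow> \<exists>u \<in> Hom C W K. k \<cdot> u = h"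
  shows "is_kernel C k f"
proof -
  have "\<exists>!u. u \<in> Hom C W K \<and> k \<cdot> u = h" if "h \<in> Hom C W X" "f \<cdot> h = Zero C W Y" for W h
    using assms(5)[OF that] monic_cancel[OF assms(3)] in_HomD(2)[OF k] by metis
  then show ?thesis using assms(4) in_HomD[OF k] in_HomD[OF f] unfolding is_kernel_def by simp
qed

lemma biproduct_zero:
  assumes "is_biproduct C X Y B i j p q"
  shows "q \<cdot> i = Zero C X Y"
proof -
  have i: "i \<in> Hom C X B" and j: "j \<in> Hom C Y B" and p: "p \<in> Hom C B X" and q: "q \<in> Hom C B Y"
    and pi: "p \<cdot> i = Id C X" and qj: "q \<cdot> j = Id C Y"
    and sum: "Add C (i \<cdot> p) (j \<cdot> q) = Id C B"
    using assms by (auto simp: is_biproduct_def)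
  note H = in_HomD[OF i] in_HomD[OF j] in_HomD[OF p] in_HomD[OF q]
  have ip: "i \<cdot> p \<in> Hom C B B" and jq: "j \<cdot> q \<in> Hom C B B" using H by (simp_all add: Hom_def)
  have qi: "q \<cdot> i \<in> Hom C X Y" using H by (simp add: Hom_def)
  have "q \<cdot> Add C (i \<cdot> p) (j \<cdot> q) = Add C (q \<cdot> (i \<cdot> p)) (q \<cdot> (j \<cdot> q))"
    by (rule Comp_Add_right[OF ip jq q])
  moreover have "q \<cdot> (j \<cdot> q) = q" using assoc[of q j q] H qj by simp
  moreover have "q \<cdot> (i \<cdot> p) \<in> Hom C B Y" using H by (simp add: Hom_def)
  ultimately have "q \<cdot> (i \<cdot> p) = Zero C B Y" using Zero_if_Add_eq q sum H by simp
  then have "(q \<cdot> (i \<cdot> p)) \<cdot> i = Zero C X Y" using H by simp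
  moreover have "(q \<cdot> (i \<cdot> p)) \<cdot> i = q \<cdot> i" using H pi by (simp add: assoc)
  ultimately show ?thesis by simp
qed

lemma biproduct_kernel:
  assumes "is_biproduct C X Y B i j p q"
  shows "is_kernel C i q"
proof -
  have i: "i \<in> Hom C X B" and j: "j \<in> Hom C Y B" and p: "p \<in> Hom C B X" and q: "q \<in> Hom C B Y"
    and pi: "p \<cdot> i = Id C X" and sum: "Add C (i \<cdot> p) (j \<cdot> q) = Id C B"
    using assms by (auto simp: is_biproduct_def)
  note H = in_HomD[OF i] in_HomD[OF j] in_HomD[OF p] in_HomD[OF q]
  have ip: "i \<cdot> p \<in> Hom C B B" and jq: "j \<cdot> q \<in> Hom C B B" using H by (simp_all add: Hom_def)
  have lift: "i \<cdot> (p \<cdot> h) = h" if h: "h \<in> Hom C W B" and qh: "q \<cdot> h = Zero C W Y" for W h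
  proof -
    have "h = Add C ((i \<cdot> p) \<cdot> h) ((j \<cdot> q) \<cdot> h)"
      using Comp_Add_left[OF h ip jq] sum in_HomD[OF h] by simp
    also have "(j \<cdot> q) \<cdot> h = Zero C W B"
      using qh in_HomD[OF h] H by (simp add: assoc)
    also have "Add C ((i \<cdot> p) \<cdot> h) (Zero C W B) = (i \<cdot> p) \<cdot> h"
      using Add_Zero Comp_closed[OF h ip] by blast
    finally show ?thesis using in_HomD[OF h] H by (simp add: assoc)
  qed
  show ?thesis
  proof (rule kernelI[OF i q])
    show "q \<cdot> i = Zero C X Y" by (rule biproduct_zero[OF assms])
    show "monic C i"
    proof (rule monicI[OF i])
      fix W g assume g: "g \<in> Hom C W X" "i \<cdot> g = Zero C W B"
      have "(p \<cdot> i) \<cdot> g = Zero C W X"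
        using g in_HomD[OF g(1)] H by (simp add: assoc)
      then show "g = Zero C W X" using pi in_HomD[OF g(1)] by simp
    qed
  qed (use lift Comp_closed p in blast)
qed

lemma null_object_iff_Id: "null_object C N \<longleftrightarrow> N \<in> Obj C \<and> Id C N = Zero C N N"
proof
  assume "null_object C N"
  then show "N \<in> Obj C \<and> Id C N = Zero C N N"
    unfolding null_object_def using Id_closed Zero_closed by metis
next
  assume N: "N \<in> Obj C \<and> Id C N = Zero C N N"
  have "f = Zero C N X" if "f \<in> Hom C N X" for f X
    using in_HomD[OF that] Comp_Id(2)[of f N] N Comp_Zero[of f N N] by simp
  moreover have "f = Zero C X N" if "f \<in> Hom C X N" for f X
    using in_HomD[OF that] Comp_Id(1)[of f N] N Zero_Comp[of f N N] by simp
  ultimately show "null_object C N"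
    unfolding null_object_def using N Zero_closed by metis
qed

end

section \<open>Duality\<close>

definition op_cat :: "('o, 'm, 'x) ab_cat_scheme \<Rightarrow> ('o, 'm, 'x) ab_cat_scheme" where
  "op_cat C = C\<lparr>Dom := Cod C, Cod := Dom C, Comp := \<lambda>g f. f \<cdot>\<^bsub>C\<^esub> g, Zero := \<lambda>X Y. Zero C Y X\<rparr>"

lemma op_cat_simps [simp]:
  "Obj (op_cat C) = Obj C" "Arr (op_cat C) = Arr C" "Dom (op_cat C) = Cod C"
  "Cod (op_cat C) = Dom C" "Id (op_cat C) = Id C" "g \<cdot>\<^bsub>op_cat C\<^esub> f = f \<cdot>\<^bsub>C\<^esub> g"
  "Add (op_cat C) = Add C" "Zero (op_cat C) X Y = Zero C Y X"
  "Hom (op_cat C) X Y = Hom C Y X" "hom_group (op_cat C) X Y = hom_group C Y X"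
  by (auto simp: op_cat_def Hom_def hom_group_def)

lemma op_notions [simp]:
  "monic (op_cat C) f = epic C f" "epic (op_cat C) f = monic C f"
  "is_kernel (op_cat C) k f = is_cokernel C k f" "is_cokernel (op_cat C) k f = is_kernel C k f"
  "is_biproduct (op_cat C) X Y B i j p q = is_biproduct C X Y B p q i j"
  "null_object (op_cat C) N = null_object C N"
  by (auto simp: monic_def epic_def is_kernel_def is_cokernel_def is_biproduct_def null_object_def)

lemma (in preadditive_category) preadditive_op: "preadditive_category (op_cat C)"
  by (intro preadditive_category.intro category.intro preadditive_category_axioms.intro;
      simp only: op_cat_simps)
    (auto intro: Dom_closed Cod_closed Id_closed Comp_closed Comp_Id_left Comp_Id_right
      Comp_assoc[symmetric] Comp_Add_left Comp_Add_right hom_comm_group)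

lemma (in abelian_category) abelian_op: "abelian_category (op_cat C)"
proof -
  interpret op: preadditive_category "op_cat C" by (rule preadditive_op)
  show ?thesis
  proof
    show "\<exists>N. null_object (op_cat C) N" using ex_null_object by simp
    show "\<exists>B i j p q. is_biproduct (op_cat C) X Y B i j p q"
      if "X \<in> Obj (op_cat C)" "Y \<in> Obj (op_cat C)" for X Y
      using ex_biproduct[of X Y] that unfolding op_notions op_cat_simps by blast
    show "\<exists>k. is_kernel (op_cat C) k f" "\<exists>c. is_cokernel (op_cat C) c f"
      if "f \<in> Arr (op_cat C)" for f
      using ex_kernel[of f] ex_cokernel[of f] that by simp_all
    show "\<exists>f. is_kernel (op_cat C) m f" if "monic (op_cat C) m" for m
      using epic_is_cokernel[of m] that by simp
    show "\<exists>f. is_cokernel (op_cat C) e f" if "epic (op_cat C) e" for e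
      using monic_is_kernel[of e] that by simp
  qed
qed

context preadditive_category
begin

lemma epicI:
  assumes "f \<in> Hom C X Y" "\<And>W g. g \<in> Hom C Y W \<Longrightarrow> g \<cdot> f = Zero C X W \<Longrightarrow> g = Zero C Y W"
  shows "epic C f"
  using preadditive_category.monicI[OF preadditive_op, of f Y X] assms by simp

lemma epic_zero:
  assumes "epic C f" "f \<in> Hom C X Y" "g \<in> Hom C Y W" "g \<cdot> f = Zero C X W"
  shows "g = Zero C Y W"
  using preadditive_category.monic_zero[OF preadditive_op, of f Y X g W] assms by simp

lemma cokernelD:
  assumes "is_cokernel C c f" "f \<in> Hom C X Y"
  shows "c \<in> Hom C Y (Cod C c)" "c \<cdot> f = Zero C X (Cod C c)" "epic C c"
    and "\<And>W h. h \<in> Hom C Y W \<Longrightarrow> h \<cdot> f = Zero C X W \<Longrightarrow> \<exists>u \<in> Hom C (Cod C c) W. u \<cdot> c = h"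
  using preadditive_category.kernelD[OF preadditive_op, of c f Y X] assms by simp_all

lemma cokernelI:
  assumes "c \<in> Hom C Y Q" "f \<in> Hom C X Y" "epic C c" "c \<cdot> f = Zero C X Q"
    and "\<And>W h. h \<in> Hom C Y W \<Longrightarrow> h \<cdot> f = Zero C X W \<Longrightarrow> \<exists>u \<in> Hom C Q W. u \<cdot> c = h"
  shows "is_cokernel C c f"
  using preadditive_category.kernelI[OF preadditive_op, of c Q Y f X] assms by simp

lemma biproduct_short_exact:
  assumes "is_biproduct C X Y B i j p q"
  shows "short_exact C i q"
proof -
  have i: "i \<in> Hom C X B" and j: "j \<in> Hom C Y B" and p: "p \<in> Hom C B X" and q: "q \<in> Hom C B Y"
    and sum: "Add C (i \<cdot> p) (j \<cdot> q) = Id C B"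
    using assms by (auto simp: is_biproduct_def)
  note H = in_HomD[OF i] in_HomD[OF j] in_HomD[OF p] in_HomD[OF q]
  have "i \<cdot> p \<in> Hom C B B" "j \<cdot> q \<in> Hom C B B" using H by (simp_all add: Hom_def)
  then have "Add C (j \<cdot> q) (i \<cdot> p) = Id C B" using Add_commute sum by metis
  then have swap: "is_biproduct (op_cat C) Y X B q p j i"
    using assms by (simp add: is_biproduct_def)
  have "is_cokernel C q i"
    using preadditive_category.biproduct_kernel[OF preadditive_op swap] by simp
  then show ?thesis using biproduct_kernel[OF assms] by (simp add: short_exact_def)
qed

end
section \<open>Abelian categories\<close>

context preadditive_category
begin

lemma short_exactD:
  assumes "short_exact C f g" "f \<in> Hom C X Y" "g \<in> Hom C Y W"
  shows "monic C f" "epic C g" "g \<cdot> f = Zero C X W"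
    and "\<And>V h. h \<in> Hom C V Y \<Longrightarrow> g \<cdot> h = Zero C V W \<Longrightarrow> \<exists>u \<in> Hom C V X. f \<cdot> u = h"
    and "\<And>V h. h \<in> Hom C Y V \<Longrightarrow> h \<cdot> f = Zero C X V \<Longrightarrow> \<exists>u \<in> Hom C W V. u \<cdot> g = h"
  using assms kernelD[of f g Y W] cokernelD[of g f X Y] in_HomD(2)[OF assms(2)] in_HomD(3)[OF assms(3)]
  unfolding short_exact_def by simp_all

lemma is_kernel_of_cokernel:
  assumes ker: "is_kernel C m g" and coker: "is_cokernel C c m" and m: "m \<in> Hom C I Y"
  shows "is_kernel C m c"
proof -
  obtain W where g: "g \<in> Hom C Y W"
    using ker m by (auto simp: is_kernel_def Hom_def)
  obtain Q where c: "c \<in> Hom C Y Q"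
    using cokernelD(1)[OF coker m] by blast
  obtain g' where g': "g' \<in> Hom C Q W" "g' \<cdot> c = g"
    using cokernelD(4)[OF coker m g] kernelD(2)[OF ker g] in_HomD(2)[OF m] in_HomD(3)[OF c] by auto
  note H = in_HomD[OF m] in_HomD[OF g] in_HomD[OF c] in_HomD[OF g'(1)]
  show ?thesis
  proof (rule kernelI[OF m c kernelD(3)[OF ker g]])
    show "c \<cdot> m = Zero C I Q" using cokernelD(2)[OF coker m] H by simp
    fix V h assume h: "h \<in> Hom C V Y" "c \<cdot> h = Zero C V Q"
    have "g \<cdot> h = g' \<cdot> (c \<cdot> h)" unfolding g'(2)[symmetric] using H in_HomD[OF h(1)] by (simp add: assoc)
    also have "\<dots> = Zero C V W" using H h(2) in_HomD[OF h(1)] by simp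
    finally show "\<exists>u \<in> Hom C V I. m \<cdot> u = h" using kernelD(4)[OF ker g h(1)] H by simp
  qed
qed

end

context abelian_category
begin

lemma kernel_obtain:
  assumes "f \<in> Hom C X Y"
  obtains K k where "k \<in> Hom C K X" "is_kernel C k f"
  using ex_kernel[OF in_HomD(1)[OF assms]] kernelD(1)[OF _ assms] by blast

lemma cokernel_obtain:
  assumes "f \<in> Hom C X Y"
  obtains Q c where "c \<in> Hom C Y Q" "is_cokernel C c f"
  using ex_cokernel[OF in_HomD(1)[OF assms]] cokernelD(1)[OF _ assms] by blast

lemma monic_short_exact:
  assumes "monic C m" "m \<in> Hom C I Y" "is_cokernel C c m"
  shows "short_exact C m c"
  using monic_is_kernel[OF assms(1)] is_kernel_of_cokernel[OF _ assms(3,2)] assms(3)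
  unfolding short_exact_def by blast

lemma epic_short_exact:
  assumes "epic C e" "e \<in> Hom C X I" "is_kernel C k e"
  shows "short_exact C k e"
  using abelian_category.monic_short_exact[OF abelian_op, of e I X k] assms
  by (simp add: short_exact_def)

text \<open>The monic part of \<open>f\<close> is the kernel of its cokernel. If an arrow \<open>w\<close> kills the remaining part
  \<open>e\<close>, then \<open>f\<close> factors through the subobject \<open>m \<cdot> k\<close> where \<open>k\<close> is the kernel of \<open>w\<close>; that
  subobject is itself a kernel, so it contains the kernel of the cokernel of \<open>f\<close>, and \<open>k\<close> splits.\<close>

lemma epi_mono_factorization:
  assumes f: "f \<in> Hom C X Y"
  obtains I e m where "e \<in> Hom C X I" "m \<in> Hom C I Y" "epic C e" "monic C m" "m \<cdot> e = f"
proof -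
  obtain Q c where c: "c \<in> Hom C Y Q" "is_cokernel C c f" using cokernel_obtain[OF f] .
  obtain I m where m: "m \<in> Hom C I Y" "is_kernel C m c" using kernel_obtain[OF c(1)] .
  have cm: "c \<cdot> m = Zero C I Q" using kernelD(2)[OF m(2) c(1)] in_HomD(2)[OF m(1)] by simp
  have mono: "monic C m" by (rule kernelD(3)[OF m(2) c(1)])
  have cf: "c \<cdot> f = Zero C X Q" using cokernelD(2)[OF c(2) f] in_HomD(3)[OF c(1)] by simp
  obtain e where e: "e \<in> Hom C X I" "m \<cdot> e = f"
    using kernelD(4)[OF m(2) c(1) f cf] in_HomD(2)[OF m(1)] by auto
  have "epic C e"
  proof (rule epicI[OF e(1)])
    fix W w assume w: "w \<in> Hom C I W" "w \<cdot> e = Zero C X W"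
    obtain K k where k: "k \<in> Hom C K I" "is_kernel C k w" using kernel_obtain[OF w(1)] .
    have wk: "w \<cdot> k = Zero C K W" using kernelD(2)[OF k(2) w(1)] in_HomD(2)[OF k(1)] by simp
    obtain e' where e': "e' \<in> Hom C X K" "k \<cdot> e' = e"
      using kernelD(4)[OF k(2) w(1) e(1) w(2)] in_HomD(2)[OF k(1)] by auto
    note H = in_HomD[OF m(1)] in_HomD[OF e(1)] in_HomD[OF w(1)] in_HomD[OF k(1)] in_HomD[OF e'(1)]
      in_HomD[OF c(1)]
    have mk: "m \<cdot> k \<in> Hom C K Y" using H by (simp add: Hom_def)
    have "monic C (m \<cdot> k)" using monic_Comp[OF kernelD(3)[OF k(2) w(1)] mono] H by simp
    then obtain d where d: "is_kernel C (m \<cdot> k) d" using monic_is_kernel by blast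
    obtain D where dD: "d \<in> Hom C Y D"
      using d mk by (auto simp: is_kernel_def Hom_def)
    have dmk: "d \<cdot> (m \<cdot> k) = Zero C K D" using kernelD(2)[OF d dD] in_HomD(2)[OF mk] by simp
    have "f = (m \<cdot> k) \<cdot> e'" using H e(2) e'(2) by (simp add: assoc)
    then have "d \<cdot> f = (d \<cdot> (m \<cdot> k)) \<cdot> e'" using H in_HomD[OF dD] in_HomD[OF mk] by (simp add: assoc)
    also have "\<dots> = Zero C X D" using dmk H in_HomD[OF dD] by simp
    finally obtain d' where d': "d' \<in> Hom C Q D" "d' \<cdot> c = d"
      using cokernelD(4)[OF c(2) f dD] in_HomD(3)[OF c(1)] by auto
    have "d \<cdot> m = d' \<cdot> (c \<cdot> m)" using H in_HomD[OF d'(1)] d'(2) by (simp add: assoc[symmetric])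
    also have "\<dots> = Zero C I D" using cm H in_HomD[OF d'(1)] by simp
    finally obtain s where s: "s \<in> Hom C I K" "(m \<cdot> k) \<cdot> s = m"
      using kernelD(4)[OF d dD m(1)] in_HomD(2)[OF mk] by auto
    have "m \<cdot> (k \<cdot> s) = m \<cdot> Id C I" using s H in_HomD[OF s(1)] by (simp add: assoc)
    then have "k \<cdot> s = Id C I"
      by (rule monic_cancel[OF mono]) (use H in_HomD[OF s(1)] in \<open>simp_all add: Hom_def\<close>)
    then have "w = (w \<cdot> k) \<cdot> s" using H in_HomD[OF s(1)] by (simp add: assoc)
    then show "w = Zero C I W" using wk H in_HomD[OF s(1)] by simp
  qed
  then show thesis using that e m(1) mono by blast
qed

text \<open>Epic arrows are stable under pullback: \<open>y\<close> lifts along \<open>e\<close> after replacing its domain by an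
  epic cover. This is what makes diagram chases with generalized elements possible. The pullback
  is the kernel of \<open>e - y\<close> on the biproduct.\<close>

lemma epic_local_lift:
  assumes e: "e \<in> Hom C X Y" and epi: "epic C e" and y: "y \<in> Hom C T Y"
  obtains V t x where "t \<in> Hom C V T" "epic C t" "x \<in> Hom C V X" "e \<cdot> x = y \<cdot> t"
proof -
  obtain B i j p q where bip: "is_biproduct C X T B i j p q"
    using ex_biproduct in_HomD(4)[OF e] in_HomD(4)[OF y] by blast
  then have i: "i \<in> Hom C X B" and j: "j \<in> Hom C T B" and p: "p \<in> Hom C B X" and q: "q \<in> Hom C B T"
    and pi: "p \<cdot> i = Id C X" and qj: "q \<cdot> j = Id C T"
    by (auto simp: is_biproduct_def)
  have qi: "q \<cdot> i = Zero C X T" by (rule biproduct_zero[OF bip])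
  note H = in_HomD[OF e] in_HomD[OF y] in_HomD[OF i] in_HomD[OF j] in_HomD[OF p] in_HomD[OF q]
  have ep: "e \<cdot> p \<in> Hom C B Y" and yq: "y \<cdot> q \<in> Hom C B Y" using H by (simp_all add: Hom_def)
  obtain u where u: "u \<in> Hom C B Y" "Add C u (y \<cdot> q) = e \<cdot> p" using ex_difference[OF ep yq] .
  obtain V k where k: "k \<in> Hom C V B" "is_kernel C k u" using kernel_obtain[OF u(1)] .
  note H = H in_HomD[OF u(1)] in_HomD[OF k(1)]
  have uk: "u \<cdot> k = Zero C V Y" using kernelD(2)[OF k(2) u(1)] H by simp
  have "(u \<cdot> i) = e"
  proof -
    have "Add C (u \<cdot> i) ((y \<cdot> q) \<cdot> i) = (e \<cdot> p) \<cdot> i"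
      using Comp_Add_left[OF i u(1) yq] u(2) by simp
    moreover have "(y \<cdot> q) \<cdot> i = Zero C X Y" "(e \<cdot> p) \<cdot> i = e" using H qi pi by (simp_all add: assoc)
    moreover have "u \<cdot> i \<in> Hom C X Y" using H by (simp add: Hom_def)
    ultimately show ?thesis using Add_Zero(1) by simp
  qed
  then have "epic C u" using epic_of_Comp[of u i] epi H by simp
  then have coker: "is_cokernel C u k" using epic_short_exact[OF _ u(1) k(2)] by (simp add: short_exact_def)
  have epi': "epic C (q \<cdot> k)"
  proof (rule epicI)
    show "q \<cdot> k \<in> Hom C V T" using H by (simp add: Hom_def)
    fix W w assume w: "w \<in> Hom C T W" "w \<cdot> (q \<cdot> k) = Zero C V W"
    note H = H in_HomD[OF w(1)]
    have wq: "w \<cdot> q \<in> Hom C B W" and "(w \<cdot> q) \<cdot> k = Zero C V W"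
      using w(2) H by (simp_all add: Hom_def assoc)
    then obtain v where v: "v \<in> Hom C Y W" "v \<cdot> u = w \<cdot> q"
      using cokernelD(4)[OF coker k(1)] H by auto
    have "v \<cdot> e = (v \<cdot> u) \<cdot> i" using \<open>u \<cdot> i = e\<close> H in_HomD[OF v(1)] by (simp add: assoc)
    also have "\<dots> = Zero C X W" using v(2) qi H by (simp add: assoc)
    finally have "v = Zero C Y W" by (rule epic_zero[OF epi e v(1)])
    then have "w \<cdot> q = Zero C B W" using v(2) H by simp
    moreover have "w = (w \<cdot> q) \<cdot> j" using qj H by (simp add: assoc)
    ultimately show "w = Zero C T W" using H by simp
  qed
  have "e \<cdot> (p \<cdot> k) = y \<cdot> (q \<cdot> k)"
  proof -
    have "Add C (u \<cdot> k) ((y \<cdot> q) \<cdot> k) = (e \<cdot> p) \<cdot> k"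
      using Comp_Add_left[OF k(1) u(1) yq] u(2) by simp
    moreover have "(y \<cdot> q) \<cdot> k \<in> Hom C V Y" using H by (simp add: Hom_def)
    ultimately have "(y \<cdot> q) \<cdot> k = (e \<cdot> p) \<cdot> k" using uk Add_Zero(2) by simp
    then show ?thesis using H by (simp add: assoc)
  qed
  then show thesis using that[of "q \<cdot> k" V "p \<cdot> k"] epi' H by (simp add: Hom_def)
qed

text \<open>Exactness at \<open>Y\<close> in terms of generalized elements: what the cokernel of \<open>f\<close> kills comes
  locally from \<open>f\<close>.\<close>

lemma exact_local_lift:
  assumes f: "f \<in> Hom C X Y" and c: "is_cokernel C c f" "c \<in> Hom C Y Q"
    and y: "y \<in> Hom C T Y" "c \<cdot> y = Zero C T Q"
  obtains V t x where "t \<in> Hom C V T" "epic C t" "x \<in> Hom C V X" "f \<cdot> x = y \<cdot> t"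
proof -
  obtain I e m where e: "e \<in> Hom C X I" "epic C e" and m: "m \<in> Hom C I Y" "monic C m" "m \<cdot> e = f"
    using epi_mono_factorization[OF f] by blast
  note H = in_HomD[OF f] in_HomD[OF c(2)] in_HomD[OF y(1)] in_HomD[OF e(1)] in_HomD[OF m(1)]
  obtain g where g: "is_kernel C m g" using monic_is_kernel[OF m(2)] by blast
  obtain W where gW: "g \<in> Hom C Y W" using g H by (auto simp: is_kernel_def Hom_def)
  have "g \<cdot> m = Zero C I W" using kernelD(2)[OF g gW] H by simp
  then have "g \<cdot> f = Zero C X W"
    unfolding m(3)[symmetric] using H in_HomD[OF gW] by (simp add: assoc[symmetric])
  then obtain g' where g': "g' \<in> Hom C Q W" "g' \<cdot> c = g"
    using cokernelD(4)[OF c(1) f gW] H by auto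
  have "g \<cdot> y = Zero C T W"
    unfolding g'(2)[symmetric] using H y(2) in_HomD[OF g'(1)] by (simp add: assoc)
  then obtain z where z: "z \<in> Hom C T I" "m \<cdot> z = y"
    using kernelD(4)[OF g gW y(1)] H by auto
  obtain V t x where t: "t \<in> Hom C V T" "epic C t" "x \<in> Hom C V X" "e \<cdot> x = z \<cdot> t"
    using epic_local_lift[OF e z(1)] .
  note H = H in_HomD[OF z(1)] in_HomD[OF t(1)] in_HomD[OF t(3)]
  have "f \<cdot> x = m \<cdot> (e \<cdot> x)" unfolding m(3)[symmetric] using H by (simp add: assoc)
  also have "\<dots> = y \<cdot> t" unfolding t(4) z(2)[symmetric] using H by (simp add: assoc)
  finally show thesis using that t by blast
qed

end

section \<open>Extensions\<close>

context preadditive_category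
begin

lemma kernel_of_monic_Comp:
  assumes e: "e \<in> Hom C X I" and m: "monic C m" "m \<in> Hom C I Y" and k: "is_kernel C k e"
  shows "is_kernel C k (m \<cdot> e)"
proof -
  define K where "K = Dom C k"
  have kK: "k \<in> Hom C K X" and ek: "e \<cdot> k = Zero C K I"
    using kernelD(1,2)[OF k e] by (simp_all add: K_def)
  note H = in_HomD[OF e] in_HomD[OF m(2)] in_HomD[OF kK]
  have me: "m \<cdot> e \<in> Hom C X Y" using H by (simp add: Hom_def)
  show ?thesis
  proof (rule kernelI[OF kK me kernelD(3)[OF k e]])
    show "m \<cdot> e \<cdot> k = Zero C K Y" using H ek by (simp add: assoc)
    fix W h assume h: "h \<in> Hom C W X" "m \<cdot> e \<cdot> h = Zero C W Y"
    have eh: "e \<cdot> h \<in> Hom C W I" "m \<cdot> (e \<cdot> h) = Zero C W Y"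
      using H in_HomD[OF h(1)] h(2) by (simp_all add: Hom_def assoc)
    show "\<exists>u\<in>Hom C W K. k \<cdot> u = h"
      using kernelD(4)[OF k e h(1) monic_zero[OF m eh]] by (simp add: K_def)
  qed
qed

lemma cokernel_of_epic_Comp:
  assumes "m \<in> Hom C I Y" "epic C e" "e \<in> Hom C X I" "is_cokernel C c m"
  shows "is_cokernel C c (m \<cdot> e)"
  using preadditive_category.kernel_of_monic_Comp[OF preadditive_op, of m Y I e X c] assms by simp

text \<open>The cokernel of \<open>f\<close> is computed in two stages: after dividing \<open>Y\<close> by the image of \<open>X'\<close>, what
  remains of \<open>f\<close> is an arrow \<open>g\<close> on \<open>X''\<close>.\<close>

lemma cokernel_on_extension:
  assumes ip: "short_exact C i p" "i \<in> Hom C X' X" "p \<in> Hom C X X''"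
    and f: "f \<in> Hom C X Y"
    and c: "is_cokernel C c (f \<cdot> i)" "c \<in> Hom C Y Y'"
    and g: "g \<in> Hom C X'' Y'" "g \<cdot> p = c \<cdot> f"
    and d: "is_cokernel C d g" "d \<in> Hom C Y' D"
  shows "is_cokernel C (d \<cdot> c) f"
proof -
  note S = short_exactD[OF ip]
  note H = in_HomD[OF ip(2)] in_HomD[OF ip(3)] in_HomD[OF f] in_HomD[OF c(2)] in_HomD[OF g(1)]
    in_HomD[OF d(2)]
  have fi: "f \<cdot> i \<in> Hom C X' Y" and dc: "d \<cdot> c \<in> Hom C Y D" using H by (simp_all add: Hom_def)
  show ?thesis
  proof (rule cokernelI[OF dc f])
    show "epic C (d \<cdot> c)"
      using epic_Comp[OF cokernelD(3)[OF c(1) fi] cokernelD(3)[OF d(1) g(1)]] H by simp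
    have dg: "d \<cdot> g = Zero C X'' D" using cokernelD(2)[OF d(1) g(1)] H by simp
    have "d \<cdot> c \<cdot> f = (d \<cdot> g) \<cdot> p" using H g(2) by (simp add: assoc)
    then show "d \<cdot> c \<cdot> f = Zero C X D" using dg H by simp
    fix W h assume h: "h \<in> Hom C Y W" "h \<cdot> f = Zero C X W"
    have "h \<cdot> (f \<cdot> i) = Zero C X' W"
      using H in_HomD[OF h(1)] h(2) by (simp add: assoc[symmetric])
    then obtain h' where h': "h' \<in> Hom C Y' W" "h' \<cdot> c = h"
      using cokernelD(4)[OF c(1) fi h(1)] H by auto
    have h'g: "h' \<cdot> g \<in> Hom C X'' W" using H in_HomD[OF h'(1)] by (simp add: Hom_def)
    have "(h' \<cdot> g) \<cdot> p = (h' \<cdot> c) \<cdot> f" using H in_HomD[OF h'(1)] g(2) by (simp add: assoc)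
    then have "(h' \<cdot> g) \<cdot> p = Zero C X W" using h'(2) h(2) by simp
    then have "h' \<cdot> g = Zero C X'' W" using epic_zero[OF S(2) ip(3) h'g] by blast
    then obtain v where v: "v \<in> Hom C D W" "v \<cdot> d = h'"
      using cokernelD(4)[OF d(1) g(1) h'(1)] H by auto
    have "v \<cdot> (d \<cdot> c) = h" using v(2) h'(2) H in_HomD[OF v(1)] by (simp add: assoc[symmetric])
    then show "\<exists>u\<in>Hom C D W. u \<cdot> (d \<cdot> c) = h" using v(1) by blast
  qed
qed

lemma short_exact_op: "short_exact (op_cat C) f g = short_exact C g f"
  by (auto simp: short_exact_def)

lemma kernel_into_extension:
  assumes "short_exact C j r" "j \<in> Hom C Y' Y" "r \<in> Hom C Y Y''"
    and "f \<in> Hom C X Y"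
    and "is_kernel C k (r \<cdot> f)" "k \<in> Hom C X' X"
    and "h \<in> Hom C X' Y'" "j \<cdot> h = f \<cdot> k"
    and "is_kernel C l h" "l \<in> Hom C D X'"
  shows "is_kernel C (k \<cdot> l) f"
  using preadditive_category.cokernel_on_extension[OF preadditive_op, of r j Y'' Y Y' f X k X' h l D]
    assms by (simp add: short_exact_op)

end

context abelian_category
begin

text \<open>The kernels in the map from \<open>0 \<rightarrow> X' \<rightarrow> X \<rightarrow> X'' \<rightarrow> 0\<close> to \<open>0 \<rightarrow> im (f \<cdot> i) \<rightarrow> Y \<rightarrow> Y' \<rightarrow> 0\<close> induced
  by \<open>f\<close> form a short exact sequence by the snake lemma: the connecting map lands in the cokernel of
  the epic \<open>X' \<rightarrow> im (f \<cdot> i)\<close>, which vanishes. The proof below is the corresponding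
  diagram chase: an element of \<open>N\<close> lifts to \<open>X\<close>, and is then corrected by an element of \<open>X'\<close>.\<close>

lemma kernel_on_extension:
  assumes ip: "short_exact C i p" "i \<in> Hom C X' X" "p \<in> Hom C X X''"
    and f: "f \<in> Hom C X Y"
    and k: "is_kernel C k (f \<cdot> i)" "k \<in> Hom C K X'"
    and c: "is_cokernel C c (f \<cdot> i)" "c \<in> Hom C Y Y'"
    and g: "g \<in> Hom C X'' Y'" "g \<cdot> p = c \<cdot> f"
    and n: "is_kernel C n g" "n \<in> Hom C N X''"
    and l: "is_kernel C l f" "l \<in> Hom C L X"
  shows "\<exists>a \<in> Hom C K L. \<exists>q \<in> Hom C L N. short_exact C a q"
proof -
  note S = short_exactD[OF ip]
  note H = in_HomD[OF ip(2)] in_HomD[OF ip(3)] in_HomD[OF f] in_HomD[OF k(2)] in_HomD[OF c(2)]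
    in_HomD[OF g(1)] in_HomD[OF n(2)] in_HomD[OF l(2)]
  have fi: "f \<cdot> i \<in> Hom C X' Y" and ik: "i \<cdot> k \<in> Hom C K X" and pl: "p \<cdot> l \<in> Hom C L X''"
    using H by (simp_all add: Hom_def)
  have fl: "f \<cdot> l = Zero C L Y" using kernelD(2)[OF l(1) f] H by simp
  have gn: "g \<cdot> n = Zero C N Y'" using kernelD(2)[OF n(1) g(1)] H by simp
  have fik: "f \<cdot> (i \<cdot> k) = Zero C K Y" using kernelD(2)[OF k(1) fi] H by (simp add: assoc)
  have mono: "monic C n" "monic C l" "monic C k"
    using kernelD(3)[OF n(1) g(1)] kernelD(3)[OF l(1) f] kernelD(3)[OF k(1) fi] by auto
  obtain a where a: "a \<in> Hom C K L" "l \<cdot> a = i \<cdot> k"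
    using kernelD(4)[OF l(1) f ik fik] H by auto
  have "g \<cdot> (p \<cdot> l) = c \<cdot> (f \<cdot> l)" using H g(2) by (simp add: assoc[symmetric])
  also have "\<dots> = Zero C L Y'" using fl H by simp
  finally obtain q where q: "q \<in> Hom C L N" "n \<cdot> q = p \<cdot> l"
    using kernelD(4)[OF n(1) g(1) pl] H by auto
  note H = H in_HomD[OF a(1)] in_HomD[OF q(1)]

  have ker: "is_kernel C a q"
  proof (rule kernelI[OF a(1) q(1)])
    show "monic C a"
    proof (rule monicI[OF a(1)])
      fix W w assume w: "w \<in> Hom C W K" "a \<cdot> w = Zero C W L"
      have kw: "k \<cdot> w \<in> Hom C W X'" using H in_HomD[OF w(1)] by (simp add: Hom_def)
      have "i \<cdot> (k \<cdot> w) = l \<cdot> (a \<cdot> w)" using H in_HomD[OF w(1)] a(2) by (simp add: assoc[symmetric])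
      also have "\<dots> = Zero C W X" using H w(2) in_HomD[OF w(1)] by simp
      finally have "k \<cdot> w = Zero C W X'" by (rule monic_zero[OF S(1) ip(2) kw])
      then show "w = Zero C W K" by (rule monic_zero[OF mono(3) k(2) w(1)])
    qed
    have qa: "q \<cdot> a \<in> Hom C K N" using H by (simp add: Hom_def)
    have "n \<cdot> (q \<cdot> a) = (p \<cdot> i) \<cdot> k" using H q(2) a(2) by (simp add: reassoc[OF q(2)] assoc)
    also have "\<dots> = Zero C K X''" using H S(3) by simp
    finally show "q \<cdot> a = Zero C K N" by (rule monic_zero[OF mono(1) n(2) qa])
    fix W h assume h: "h \<in> Hom C W L" "q \<cdot> h = Zero C W N"
    note H = H in_HomD[OF h(1)]
    have lh: "l \<cdot> h \<in> Hom C W X" using H by (simp add: Hom_def)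
    have "p \<cdot> (l \<cdot> h) = n \<cdot> (q \<cdot> h)" using H q(2) by (simp add: assoc[symmetric])
    also have "\<dots> = Zero C W X''" using H h(2) by simp
    finally obtain h' where h': "h' \<in> Hom C W X'" "i \<cdot> h' = l \<cdot> h" using S(4)[OF lh] by blast
    have "(f \<cdot> i) \<cdot> h' = (f \<cdot> l) \<cdot> h" using H in_HomD[OF h'(1)] h'(2) by (simp add: assoc)
    also have "\<dots> = Zero C W Y" using fl H by simp
    finally obtain u where u: "u \<in> Hom C W K" "k \<cdot> u = h'"
      using kernelD(4)[OF k(1) fi h'(1)] H by auto
    note H = H in_HomD[OF h'(1)] in_HomD[OF u(1)]
    have "l \<cdot> (a \<cdot> u) = l \<cdot> h"
      using H h'(2) u(2) by (simp add: reassoc[OF a(2)] assoc)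
    then have "a \<cdot> u = h" by (rule monic_cancel[OF mono(2)]) (use H in \<open>simp_all add: Hom_def\<close>)
    then show "\<exists>u\<in>Hom C W K. a \<cdot> u = h" using u(1) by blast
  qed

  (* A generalized element n of X'' killed by g lifts to x in X; since c kills f x, the latter is
     locally f (i x'), and z = x - i x' is an element of the kernel of f that still lies over n. *)
  have "epic C q"
  proof -
    obtain V t x where x: "t \<in> Hom C V N" "epic C t" "x \<in> Hom C V X" "p \<cdot> x = n \<cdot> t"
      using epic_local_lift[OF ip(3) S(2) n(2)] .
    note H = H in_HomD[OF x(1)] in_HomD[OF x(3)]
    have fx: "f \<cdot> x \<in> Hom C V Y" using H by (simp add: Hom_def)
    have "c \<cdot> (f \<cdot> x) = (g \<cdot> n) \<cdot> t" using H x(4) by (simp add: reassoc[OF g(2)[symmetric]] assoc)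
    then have "c \<cdot> (f \<cdot> x) = Zero C V Y'" using gn H by simp
    then obtain V' t' x' where x': "t' \<in> Hom C V' V" "epic C t'" "x' \<in> Hom C V' X'"
      "(f \<cdot> i) \<cdot> x' = (f \<cdot> x) \<cdot> t'"
      using exact_local_lift[OF fi c fx] by blast
    note H = H in_HomD[OF x'(1)] in_HomD[OF x'(3)]
    have xt: "x \<cdot> t' \<in> Hom C V' X" and ix: "i \<cdot> x' \<in> Hom C V' X" using H by (simp_all add: Hom_def)
    obtain z where z: "z \<in> Hom C V' X" "Add C z (i \<cdot> x') = x \<cdot> t'" using ex_difference[OF xt ix] .
    note H = H in_HomD[OF z(1)]
    have "Add C (f \<cdot> z) (f \<cdot> (i \<cdot> x')) = f \<cdot> (x \<cdot> t')"
      using Comp_Add_right[OF z(1) ix f] z(2) by simp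
    also have "\<dots> = f \<cdot> (i \<cdot> x')" using x'(4) H by (simp add: assoc)
    finally have "f \<cdot> z = Zero C V' Y"
      by (rule Zero_if_Add_eq[rotated 2]) (use H in \<open>simp_all add: Hom_def\<close>)
    then obtain y where y: "y \<in> Hom C V' L" "l \<cdot> y = z"
      using kernelD(4)[OF l(1) f z(1)] H by auto
    note H = H in_HomD[OF y(1)]
    have "p \<cdot> (i \<cdot> x') = Zero C V' X''" using S(3) H by (simp add: assoc[symmetric])
    moreover have "p \<cdot> z \<in> Hom C V' X''" using H by (simp add: Hom_def)
    ultimately have "p \<cdot> z = p \<cdot> (x \<cdot> t')"
      using Comp_Add_right[OF z(1) ix ip(3)] z(2) Add_Zero(1) by simp
    then have "n \<cdot> (q \<cdot> y) = n \<cdot> (t \<cdot> t')"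
      using H y(2) by (simp add: reassoc[OF q(2)] reassoc[OF x(4)] assoc)
    then have "q \<cdot> y = t \<cdot> t'" by (rule monic_cancel[OF mono(1)]) (use H in \<open>simp_all add: Hom_def\<close>)
    then show ?thesis using epic_of_Comp[of q y] epic_Comp[OF x'(2) x(2)] H by simp
  qed
  then show ?thesis using epic_short_exact[OF _ q(1) ker] a(1) q(1) by blast
qed

lemma cokernel_into_extension:
  assumes "short_exact C j r" "j \<in> Hom C Y' Y" "r \<in> Hom C Y Y''"
    and "f \<in> Hom C X Y"
    and "is_cokernel C c (r \<cdot> f)" "c \<in> Hom C Y'' Q"
    and "is_kernel C k (r \<cdot> f)" "k \<in> Hom C X' X"
    and "h \<in> Hom C X' Y'" "j \<cdot> h = f \<cdot> k"
    and "is_cokernel C d h" "d \<in> Hom C Y' D"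
    and "is_cokernel C e f" "e \<in> Hom C Y G"
  shows "\<exists>a \<in> Hom C D G. \<exists>b \<in> Hom C G Q. short_exact C a b"
  using abelian_category.kernel_on_extension[OF abelian_op,
      of r j Y'' Y Y' f X c Q k X' h d D e G] assms
  by (auto simp: short_exact_op)

text \<open>The pullback along \<open>s\<close> of an extension \<open>P\<close> of \<open>Y\<close> by \<open>X\<close> is again an extension by \<open>X\<close>. As \<open>s\<close> is
  the kernel of \<open>r\<close>, this pullback is the kernel of \<open>r \<cdot> q\<close>.\<close>

lemma extension_restrict:
  assumes iq: "short_exact C i q" "i \<in> Hom C X P" "q \<in> Hom C P Y"
    and sr: "short_exact C s r" "s \<in> Hom C Y' Y" "r \<in> Hom C Y B"
    and k: "is_kernel C k (r \<cdot> q)" "k \<in> Hom C K P"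
  shows "\<exists>a \<in> Hom C X K. \<exists>b \<in> Hom C K Y'. short_exact C a b"
proof -
  note S = short_exactD[OF iq] and T = short_exactD[OF sr]
  note H = in_HomD[OF iq(2)] in_HomD[OF iq(3)] in_HomD[OF sr(2)] in_HomD[OF sr(3)] in_HomD[OF k(2)]
  have rq: "r \<cdot> q \<in> Hom C P B" and qk: "q \<cdot> k \<in> Hom C K Y" using H by (simp_all add: Hom_def)
  have rqk: "r \<cdot> (q \<cdot> k) = Zero C K B" using kernelD(2)[OF k(1) rq] H by (simp add: assoc)
  have mono: "monic C k" by (rule kernelD(3)[OF k(1) rq])
  have "(r \<cdot> q) \<cdot> i = Zero C X B" using S(3) H by (simp add: assoc)
  then obtain a where a: "a \<in> Hom C X K" "k \<cdot> a = i"
    using kernelD(4)[OF k(1) rq iq(2)] H by auto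
  obtain b where b: "b \<in> Hom C K Y'" "s \<cdot> b = q \<cdot> k" using T(4)[OF qk rqk] by blast
  note H = H in_HomD[OF a(1)] in_HomD[OF b(1)]
  have ker: "is_kernel C a b"
  proof (rule kernelI[OF a(1) b(1)])
    show "monic C a"
    proof (rule monicI[OF a(1)])
      fix W w assume w: "w \<in> Hom C W X" "a \<cdot> w = Zero C W K"
      have "i \<cdot> w = k \<cdot> (a \<cdot> w)" using H in_HomD[OF w(1)] by (simp add: reassoc[OF a(2)])
      then have "i \<cdot> w = Zero C W P" using H w(2) in_HomD[OF w(1)] by simp
      then show "w = Zero C W X" by (rule monic_zero[OF S(1) iq(2) w(1)])
    qed
    have ba: "b \<cdot> a \<in> Hom C X Y'" using H by (simp add: Hom_def)
    have "s \<cdot> (b \<cdot> a) = q \<cdot> i" using H a(2) by (simp add: reassoc[OF b(2)] assoc)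
    then show "b \<cdot> a = Zero C X Y'" using monic_zero[OF T(1) sr(2) ba] S(3) by simp
    fix W h assume h: "h \<in> Hom C W K" "b \<cdot> h = Zero C W Y'"
    note H = H in_HomD[OF h(1)]
    have kh: "k \<cdot> h \<in> Hom C W P" using H by (simp add: Hom_def)
    have "q \<cdot> (k \<cdot> h) = s \<cdot> (b \<cdot> h)" using H by (simp add: reassoc[OF b(2)] assoc)
    then have "q \<cdot> (k \<cdot> h) = Zero C W Y" using H h(2) by simp
    then obtain u where u: "u \<in> Hom C W X" "i \<cdot> u = k \<cdot> h" using S(4)[OF kh] by blast
    have "k \<cdot> (a \<cdot> u) = k \<cdot> h" using H in_HomD[OF u(1)] u(2) by (simp add: reassoc[OF a(2)])
    then have "a \<cdot> u = h"
      by (rule monic_cancel[OF mono]) (use H in_HomD[OF u(1)] in \<open>simp_all add: Hom_def\<close>)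
    then show "\<exists>u\<in>Hom C W X. a \<cdot> u = h" using u(1) by blast
  qed
  have "epic C b"
  proof -
    obtain V t x where x: "t \<in> Hom C V Y'" "epic C t" "x \<in> Hom C V P" "q \<cdot> x = s \<cdot> t"
      using epic_local_lift[OF iq(3) S(2) sr(2)] .
    note H = H in_HomD[OF x(1)] in_HomD[OF x(3)]
    have "(r \<cdot> q) \<cdot> x = (r \<cdot> s) \<cdot> t" using H x(4) by (simp add: assoc)
    then have "(r \<cdot> q) \<cdot> x = Zero C V B" using T(3) H by simp
    then obtain y where y: "y \<in> Hom C V K" "k \<cdot> y = x" using kernelD(4)[OF k(1) rq x(3)] H by auto
    note H = H in_HomD[OF y(1)]
    have "s \<cdot> (b \<cdot> y) = s \<cdot> t" using H y(2) x(4) by (simp add: reassoc[OF b(2)] assoc)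
    then have "b \<cdot> y = t" by (rule monic_cancel[OF T(1)]) (use H in \<open>simp_all add: Hom_def\<close>)
    then show ?thesis using epic_of_Comp[of b y] x(2) H by simp
  qed
  then show ?thesis using epic_short_exact[OF _ b(1) ker] a(1) b(1) by blast
qed

end

section \<open>Full subcategories closed under kernels and cokernels\<close>

lemma full_subcat_simps [simp]:
  "Obj (full_subcat C S) = S"
  "f \<in> Arr (full_subcat C S) \<longleftrightarrow> f \<in> Arr C \<and> Dom C f \<in> S \<and> Cod C f \<in> S"
  "Dom (full_subcat C S) = Dom C" "Cod (full_subcat C S) = Cod C" "Id (full_subcat C S) = Id C"
  "g \<cdot>\<^bsub>full_subcat C S\<^esub> f = g \<cdot>\<^bsub>C\<^esub> f"
  by (auto simp: full_subcat_def)

lemma full_subcat_ab_simps [simp]: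
  "Add (full_subcat C S) = Add C" "Zero (full_subcat C S) = Zero C"
  by (auto simp: full_subcat_def)

lemma Hom_full_subcat [simp]:
  "Hom (full_subcat C S) X Y = (if X \<in> S \<and> Y \<in> S then Hom C X Y else {})"
  by (auto simp: Hom_def)

lemma op_full_subcat: "op_cat (full_subcat C S) = full_subcat (op_cat C) S"
  by (simp add: op_cat_def full_subcat_def conj_commute)

lemma kernel_full_subcat:
  assumes "is_kernel C k f" "Dom C k \<in> S" "f \<in> Arr (full_subcat C S)"
  shows "is_kernel (full_subcat C S) k f"
  using assms unfolding is_kernel_def by simp

lemma cokernel_full_subcat:
  assumes "is_cokernel C c f" "Cod C c \<in> S" "f \<in> Arr (full_subcat C S)"
  shows "is_cokernel (full_subcat C S) c f"
  using assms unfolding is_cokernel_def by simp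

lemma (in preadditive_category) preadditive_full_subcat:
  assumes "S \<subseteq> Obj C"
  shows "preadditive_category (full_subcat C S)"
proof (intro preadditive_category.intro category.intro preadditive_category_axioms.intro)
  show "comm_group (hom_group (full_subcat C S) X Y)"
    if "X \<in> Obj (full_subcat C S)" "Y \<in> Obj (full_subcat C S)" for X Y
  proof -
    have "hom_group (full_subcat C S) X Y = hom_group C X Y"
      using that by (simp add: hom_group_def)
    then show ?thesis using hom_comm_group[of X Y] that assms by auto
  qed
qed (use assms in \<open>auto split: if_splits intro: Id_closed Comp_closed Comp_Id_left Comp_Id_right
    Comp_assoc Comp_Add_left Comp_Add_right\<close>)

text \<open>Kernels of arrows of the subcategory lie in it, so whether an arrow is monic can be tested
  there. A monic arrow is then the kernel of its cokernel, which lies in the subcategory too.\<close>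

lemma (in abelian_category) monic_full_subcat_is_kernel:
  assumes S: "S \<subseteq> Obj C"
    and ker: "\<And>X Y f. X \<in> S \<Longrightarrow> Y \<in> S \<Longrightarrow> f \<in> Hom C X Y \<Longrightarrow> \<exists>k. is_kernel C k f \<and> Dom C k \<in> S"
    and coker: "\<And>X Y f. X \<in> S \<Longrightarrow> Y \<in> S \<Longrightarrow> f \<in> Hom C X Y \<Longrightarrow> \<exists>c. is_cokernel C c f \<and> Cod C c \<in> S"
    and m: "monic (full_subcat C S) m"
  shows "\<exists>f. is_kernel (full_subcat C S) m f"
proof -
  interpret D: preadditive_category "full_subcat C S" by (rule preadditive_full_subcat[OF S])
  define X Y where "X = Dom C m" and "Y = Cod C m"
  have mX: "m \<in> Hom C X Y" and XY: "X \<in> S" "Y \<in> S"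
    using m unfolding monic_def by (simp_all add: X_def Y_def Hom_def)
  obtain k where k: "is_kernel C k m" "Dom C k \<in> S" using ker[OF XY mX] by blast
  note kD = kernelD[OF k(1) mX]
  have "k = Zero C (Dom C k) X"
    using D.monic_zero[OF m, of X Y k "Dom C k"] kD(1,2) mX XY k(2) by simp
  then have "k \<cdot> u = Zero C (Dom C k) X \<cdot> u" for u by (rule arg_cong)
  then have zero: "k \<cdot> u = Zero C W X" if "u \<in> Hom C W (Dom C k)" for u W
    using Zero_Comp[of u "Dom C k" X] in_HomD[OF that] in_HomD(4)[OF mX] by simp
  have mono: "monic C m"
  proof (rule monicI[OF mX])
    fix W g assume "g \<in> Hom C W X" "m \<cdot> g = Zero C W Y"
    then obtain u where "u \<in> Hom C W (Dom C k)" "k \<cdot> u = g" using kD(4) by blast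
    then show "g = Zero C W X" using zero by simp
  qed
  obtain c where c: "is_cokernel C c m" "Cod C c \<in> S" using coker[OF XY mX] by blast
  have "is_kernel C m c"
    using monic_short_exact[OF mono mX c(1)] by (simp add: short_exact_def)
  then show ?thesis
    using kernel_full_subcat[of C m c S] c(2) XY in_HomD(2)[OF mX]
      in_HomD(1,2,3)[OF cokernelD(1)[OF c(1) mX]] by auto
qed

lemma (in abelian_category) abelian_full_subcat:
  assumes S: "S \<subseteq> Obj C"
    and null: "\<exists>N \<in> S. null_object C N"
    and bip: "\<And>X Y. X \<in> S \<Longrightarrow> Y \<in> S \<Longrightarrow> \<exists>B i j p q. is_biproduct C X Y B i j p q \<and> B \<in> S"
    and ker: "\<And>X Y f. X \<in> S \<Longrightarrow> Y \<in> S \<Longrightarrow> f \<in> Hom C X Y \<Longrightarrow> \<exists>k. is_kernel C k f \<and> Dom C k \<in> S"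
    and coker: "\<And>X Y f. X \<in> S \<Longrightarrow> Y \<in> S \<Longrightarrow> f \<in> Hom C X Y \<Longrightarrow> \<exists>c. is_cokernel C c f \<and> Cod C c \<in> S"
  shows "abelian_category (full_subcat C S)"
proof -
  interpret D: preadditive_category "full_subcat C S" by (rule preadditive_full_subcat[OF S])
  show ?thesis
  proof
    show "\<exists>N. null_object (full_subcat C S) N"
      using null null_object_iff_Id D.null_object_iff_Id by auto
    show "\<exists>B i j p q. is_biproduct (full_subcat C S) X Y B i j p q"
      if "X \<in> Obj (full_subcat C S)" "Y \<in> Obj (full_subcat C S)" for X Y
    proof -
      have XY: "X \<in> S" "Y \<in> S" using that by simp_all
      obtain B i j p q where "is_biproduct C X Y B i j p q" "B \<in> S" using bip[OF XY] by blast
      then have "is_biproduct (full_subcat C S) X Y B i j p q"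
        using XY by (simp add: is_biproduct_def)
      then show ?thesis by blast
    qed
    show "\<exists>k. is_kernel (full_subcat C S) k f" "\<exists>c. is_cokernel (full_subcat C S) c f"
      if f: "f \<in> Arr (full_subcat C S)" for f
    proof -
      have "f \<in> Hom C (Dom C f) (Cod C f)" "Dom C f \<in> S" "Cod C f \<in> S"
        using f by (simp_all add: Hom_def)
      then show "\<exists>k. is_kernel (full_subcat C S) k f" "\<exists>c. is_cokernel (full_subcat C S) c f"
        using ker[of "Dom C f" "Cod C f" f] coker[of "Dom C f" "Cod C f" f]
          kernel_full_subcat[of C _ f S] cokernel_full_subcat[of C _ f S] f by blast+
    qed
    show "\<exists>f. is_kernel (full_subcat C S) m f" if "monic (full_subcat C S) m" for m
      by (rule monic_full_subcat_is_kernel[OF S ker coker that])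
    show "\<exists>f. is_cokernel (full_subcat C S) e f" if "epic (full_subcat C S) e" for e
    proof -
      have "\<exists>f. is_kernel (full_subcat (op_cat C) S) e f"
        by (rule abelian_category.monic_full_subcat_is_kernel[OF abelian_op])
          (use S ker coker that in \<open>simp_all add: op_full_subcat[symmetric]\<close>)
      then show ?thesis by (simp add: op_full_subcat[symmetric])
    qed
  qed
qed

text \<open>Exactness of the embedding is a statement about short exact sequences only. The kernel of an
  arrow is part of such a sequence once the arrow is replaced by its epic part, its cokernel once
  it is replaced by its monic part.\<close>

lemma (in abelian_category) full_abelian_subcategory_closed:
  assumes A: "full_abelian_subcategory C A" and XY: "X \<in> A" "Y \<in> A" and f: "f \<in> Hom C X Y"
  shows "\<exists>k. is_kernel C k f \<and> Dom C k \<in> A" and "\<exists>c. is_cokernel C c f \<and> Cod C c \<in> A"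
proof -
  interpret D: abelian_category "full_subcat C A"
    using A by (simp add: full_abelian_subcategory_def)
  have "exact_functor (full_subcat C A) C (\<lambda>X. X) (\<lambda>f. f)"
    using A by (simp add: full_abelian_subcategory_def)
  then have exact: "short_exact C g h" if "short_exact (full_subcat C A) g h" for g h
    using that by (rule exact_functor.map_short_exact)
  have fD: "f \<in> Hom (full_subcat C A) X Y" using f XY by simp
  obtain I e m where e: "e \<in> Hom (full_subcat C A) X I" "epic (full_subcat C A) e"
    and m: "m \<in> Hom (full_subcat C A) I Y" "monic (full_subcat C A) m"
    and me': "m \<cdot>\<^bsub>full_subcat C A\<^esub> e = f"
    using D.epi_mono_factorization[OF fD] by metis
  have me: "m \<cdot> e = f" using me' by simp
  have eC: "e \<in> Hom C X I" and mC: "m \<in> Hom C I Y" using e(1) m(1) by (auto split: if_splits)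
  obtain K k where k: "k \<in> Hom (full_subcat C A) K X" "is_kernel (full_subcat C A) k e"
    using D.kernel_obtain[OF e(1)] .
  obtain Q c where c: "c \<in> Hom (full_subcat C A) Y Q" "is_cokernel (full_subcat C A) c m"
    using D.cokernel_obtain[OF m(1)] .
  have KQ: "K \<in> A" "k \<in> Hom C K X" "Q \<in> A" "c \<in> Hom C Y Q" using k(1) c(1) by (auto split: if_splits)
  have ke: "short_exact C k e" by (rule exact[OF D.epic_short_exact[OF e(2,1) k(2)]])
  have mc: "short_exact C m c" by (rule exact[OF D.monic_short_exact[OF m(2,1) c(2)]])
  have "is_kernel C k (m \<cdot> e)"
    using kernel_of_monic_Comp[OF eC short_exactD(1)[OF mc mC KQ(4)] mC] ke
    by (simp add: short_exact_def)
  then show "\<exists>k. is_kernel C k f \<and> Dom C k \<in> A" unfolding me using KQ(1) in_HomD(2)[OF KQ(2)] by blast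
  have "is_cokernel C c (m \<cdot> e)"
    using cokernel_of_epic_Comp[OF mC short_exactD(2)[OF ke KQ(2) eC] eC] mc
    by (simp add: short_exact_def)
  then show "\<exists>c. is_cokernel C c f \<and> Cod C c \<in> A" unfolding me using KQ(3) in_HomD(3)[OF KQ(4)] by blast
qed

section \<open>The extension closure\<close>

context preadditive_category
begin

lemma ext_productI:
  assumes "short_exact C f g" "f \<in> Hom C P X" "g \<in> Hom C X Q" "P \<in> S" "Q \<in> T"
  shows "X \<in> ext_product C S T"
  using assms(1,4,5) in_HomD(2,3,5)[OF assms(2)] in_HomD(3)[OF assms(3)]
  unfolding ext_product_def by auto

lemma ext_productE:
  assumes "X \<in> ext_product C S T"
  obtains P Q f g where "short_exact C f g" "f \<in> Hom C P X" "g \<in> Hom C X Q" "P \<in> S" "Q \<in> T"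
proof -
  obtain f g where fg: "short_exact C f g" "Dom C f \<in> S" "Cod C f = X" "Cod C g \<in> T"
    using assms unfolding ext_product_def by blast
  then have "f \<in> Hom C (Dom C f) X" "g \<in> Hom C X (Cod C g)"
    unfolding short_exact_def is_kernel_def by (simp_all add: Hom_def)
  then show thesis using that fg by blast
qed

end

text \<open>One representative of each kernel and cokernel is required to lie in \<open>A\<close>. The inductions below
  construct particular kernels and cokernels, and prove the same form of closure for \<open>Ex_iter\<close>.\<close>

locale exact_full_subcategory = abelian_category +
  fixes A :: "'a set"
  assumes A_Obj: "A \<subseteq> Obj C"
    and A_null: "\<exists>N \<in> A. null_object C N"
    and A_kernel: "X \<in> A \<Longrightarrow> Y \<in> A \<Longrightarrow> f \<in> Hom C X Y \<Longrightarrow> \<exists>k. is_kernel C k f \<and> Dom C k \<in> A"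
    and A_cokernel: "X \<in> A \<Longrightarrow> Y \<in> A \<Longrightarrow> f \<in> Hom C X Y \<Longrightarrow> \<exists>c. is_cokernel C c f \<and> Cod C c \<in> A"
begin

lemma Ex_iter_Obj: "Ex_iter C A k \<subseteq> Obj C"
  using A_Obj by (cases k) (auto simp: ext_product_def)

text \<open>The cokernel stays in \<open>A\<close> itself, however long the filtration of \<open>X\<close> is. Therefore the arrow \<open>g\<close>
  that \<open>f\<close> induces on the top layer of \<open>X\<close> is an arrow of \<open>A\<close>, and its kernel can serve as the
  top layer of the kernel of \<open>f\<close>.\<close>

lemma kernel_cokernel_into_A:
  assumes "X \<in> Ex_iter C A k" "Y \<in> A" "f \<in> Hom C X Y"
  shows "(\<exists>l. is_kernel C l f \<and> Dom C l \<in> Ex_iter C A k) \<and> (\<exists>c. is_cokernel C c f \<and> Cod C c \<in> A)"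
  using assms
proof (induction k arbitrary: X Y f)
  case 0
  then show ?case using A_kernel A_cokernel by simp
next
  case (Suc k)
  note f = Suc.prems(3)
  obtain X' X'' i p where ip: "short_exact C i p" "i \<in> Hom C X' X" "p \<in> Hom C X X''"
    and X': "X' \<in> Ex_iter C A k" and X'': "X'' \<in> A"
    using ext_productE[OF Suc.prems(1)[unfolded Ex_iter.simps]] .
  have fi: "f \<cdot> i \<in> Hom C X' Y" by (rule Comp_closed[OF ip(2) f])
  obtain l c where l: "is_kernel C l (f \<cdot> i)" "Dom C l \<in> Ex_iter C A k"
    and c: "is_cokernel C c (f \<cdot> i)" "Cod C c \<in> A"
    using Suc.IH[OF X' Suc.prems(2) fi] by blast
  note lH = kernelD(1)[OF l(1) fi] and cH = cokernelD(1)[OF c(1) fi]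
  note H = in_HomD[OF ip(2)] in_HomD[OF ip(3)] in_HomD[OF f] in_HomD[OF cH]
  have "c \<cdot> f \<in> Hom C X (Cod C c)" by (rule Comp_closed[OF f cH])
  moreover have "c \<cdot> f \<cdot> i = Zero C X' (Cod C c)"
    using cokernelD(2)[OF c(1) fi] H by (simp add: assoc)
  ultimately obtain g where g: "g \<in> Hom C X'' (Cod C c)" "g \<cdot> p = c \<cdot> f"
    using short_exactD(5)[OF ip] by blast
  obtain n where n: "is_kernel C n g" "Dom C n \<in> A" using A_kernel[OF X'' c(2) g(1)] by blast
  obtain d where d: "is_cokernel C d g" "Cod C d \<in> A" using A_cokernel[OF X'' c(2) g(1)] by blast
  note dH = cokernelD(1)[OF d(1) g(1)]
  have coker: "is_cokernel C (d \<cdot> c) f" by (rule cokernel_on_extension[OF ip f c(1) cH g d(1) dH])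
  have Q: "Cod C (d \<cdot> c) \<in> A" using d(2) in_HomD[OF dH] in_HomD[OF cH] by simp
  obtain L m where m: "m \<in> Hom C L X" "is_kernel C m f" using kernel_obtain[OF f] .
  obtain a q where "a \<in> Hom C (Dom C l) L" "q \<in> Hom C L (Dom C n)" "short_exact C a q"
    using kernel_on_extension[OF ip f l(1) lH c(1) cH g n(1) kernelD(1)[OF n(1) g(1)] m(2,1)]
    by blast
  then have "L \<in> Ex_iter C A (Suc k)"
    using ext_productI[of a q _ L _ "Ex_iter C A k" A] l(2) n(2) by simp
  then have "Dom C m \<in> Ex_iter C A (Suc k)" using in_HomD(2)[OF m(1)] by simp
  then show ?case using m(2) coker Q by blast
qed

text \<open>The kernel of \<open>r \<cdot> f\<close> is filtered with as many layers as \<open>X\<close>, and \<open>f\<close> maps it into \<open>Y'\<close>, which has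
  one layer less than \<open>Y\<close>. The number of layers of \<open>X\<close> is the same at every stage, so that only
  \<open>n\<close> drops in the induction.\<close>

lemma kernel_cokernel_Ex_iter:
  assumes "X \<in> Ex_iter C A k" "Y \<in> Ex_iter C A n" "f \<in> Hom C X Y"
  shows "(\<exists>l. is_kernel C l f \<and> Dom C l \<in> Ex_iter C A k) \<and>
    (\<exists>c. is_cokernel C c f \<and> Cod C c \<in> Ex_iter C A n)"
  using assms
proof (induction n arbitrary: X Y f)
  case 0
  then show ?case using kernel_cokernel_into_A by simp
next
  case (Suc n)
  note f = Suc.prems(3)
  obtain Y' Y'' j r where jr: "short_exact C j r" "j \<in> Hom C Y' Y" "r \<in> Hom C Y Y''"
    and Y': "Y' \<in> Ex_iter C A n" and Y'': "Y'' \<in> A"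
    using ext_productE[OF Suc.prems(2)[unfolded Ex_iter.simps]] .
  have rf: "r \<cdot> f \<in> Hom C X Y''" by (rule Comp_closed[OF f jr(3)])
  obtain l c where l: "is_kernel C l (r \<cdot> f)" "Dom C l \<in> Ex_iter C A k"
    and c: "is_cokernel C c (r \<cdot> f)" "Cod C c \<in> A"
    using kernel_cokernel_into_A[OF Suc.prems(1) Y'' rf] by blast
  note lH = kernelD(1)[OF l(1) rf] and cH = cokernelD(1)[OF c(1) rf]
  note H = in_HomD[OF jr(2)] in_HomD[OF jr(3)] in_HomD[OF f] in_HomD[OF lH]
  have "f \<cdot> l \<in> Hom C (Dom C l) Y" by (rule Comp_closed[OF lH f])
  moreover have "r \<cdot> (f \<cdot> l) = Zero C (Dom C l) Y''"
    using kernelD(2)[OF l(1) rf] H by (simp add: assoc)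
  ultimately obtain h where h: "h \<in> Hom C (Dom C l) Y'" "j \<cdot> h = f \<cdot> l"
    using short_exactD(4)[OF jr] by blast
  obtain m d where m: "is_kernel C m h" "Dom C m \<in> Ex_iter C A k"
    and d: "is_cokernel C d h" "Cod C d \<in> Ex_iter C A n"
    using Suc.IH[OF l(2) Y' h(1)] by blast
  note mH = kernelD(1)[OF m(1) h(1)]
  have ker: "is_kernel C (l \<cdot> m) f" by (rule kernel_into_extension[OF jr f l(1) lH h m(1) mH])
  have K: "Dom C (l \<cdot> m) \<in> Ex_iter C A k" using m(2) in_HomD[OF mH] in_HomD[OF lH] by simp
  obtain G e where e: "e \<in> Hom C Y G" "is_cokernel C e f" using cokernel_obtain[OF f] .
  obtain a b where "a \<in> Hom C (Cod C d) G" "b \<in> Hom C G (Cod C c)" "short_exact C a b"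
    using cokernel_into_extension[OF jr f c(1) cH l(1) lH h d(1) cokernelD(1)[OF d(1) h(1)] e(2,1)]
    by blast
  then have "G \<in> Ex_iter C A (Suc n)"
    using ext_productI[of a b _ G _ "Ex_iter C A n" A] d(2) c(2) by simp
  then have "Cod C e \<in> Ex_iter C A (Suc n)" using in_HomD(3)[OF e(1)] by simp
  then show ?case using e(2) ker K by blast
qed

text \<open>The iterated products are bracketed to the left, so an extension by \<open>Y\<close> is rebracketed
  by splitting the topmost layer off \<open>Y\<close>.\<close>

lemma Ex_iter_extension:
  assumes "X \<in> Ex_iter C A k" "Y \<in> Ex_iter C A n"
    and "short_exact C i q" "i \<in> Hom C X P" "q \<in> Hom C P Y"
  shows "P \<in> Ex_iter C A (k + n + 1)"
  using assms
proof (induction n arbitrary: Y P i q)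
  case 0
  then show ?case using ext_productI[of i q X P Y] by simp
next
  case (Suc n)
  obtain Y' B s r where sr: "short_exact C s r" "s \<in> Hom C Y' Y" "r \<in> Hom C Y B"
    and Y': "Y' \<in> Ex_iter C A n" and B: "B \<in> A"
    using ext_productE[OF Suc.prems(2)[unfolded Ex_iter.simps]] .
  note iq = Suc.prems(3-5)
  have rq: "r \<cdot> q \<in> Hom C P B" by (rule Comp_closed[OF iq(3) sr(3)])
  obtain K l where l: "l \<in> Hom C K P" "is_kernel C l (r \<cdot> q)" using kernel_obtain[OF rq] .
  obtain a b where ab: "a \<in> Hom C X K" "b \<in> Hom C K Y'" "short_exact C a b"
    using extension_restrict[OF iq sr l(2,1)] by blast
  have "K \<in> Ex_iter C A (k + n + 1)" by (rule Suc.IH[OF Suc.prems(1) Y' ab(3,1,2)])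
  moreover have "epic C (r \<cdot> q)"
    using epic_Comp[OF short_exactD(2)[OF iq] short_exactD(2)[OF sr]]
      in_HomD(3)[OF iq(3)] in_HomD(2)[OF sr(3)] by simp
  then have "short_exact C l (r \<cdot> q)" by (rule epic_short_exact[OF _ rq l(2)])
  ultimately show ?case using ext_productI[OF _ l(1) rq _ B] by simp
qed

lemma abelian_Ex_closure: "abelian_category (full_subcat C (Ex_closure C A))"
proof (rule abelian_full_subcat)
  show "Ex_closure C A \<subseteq> Obj C" using Ex_iter_Obj by (auto simp: Ex_closure_def)
  have "A \<subseteq> Ex_closure C A" 
    using UN_upper[of 0 UNIV "Ex_iter C A"] by (simp add: Ex_closure_def)
  then show "\<exists>N\<in>Ex_closure C A. null_object C N" using A_null by blast
  fix X Y assume "X \<in> Ex_closure C A" "Y \<in> Ex_closure C A"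
  then obtain k n where XY: "X \<in> Ex_iter C A k" "Y \<in> Ex_iter C A n"
    by (auto simp: Ex_closure_def)
  obtain B i j p q where bip: "is_biproduct C X Y B i j p q"
    using ex_biproduct[OF subsetD[OF Ex_iter_Obj XY(1)] subsetD[OF Ex_iter_Obj XY(2)]] by blast
  have "B \<in> Ex_iter C A (k + n + 1)"
    using Ex_iter_extension[OF XY biproduct_short_exact[OF bip]] bip
    by (simp add: is_biproduct_def)
  then have "B \<in> Ex_closure C A" unfolding Ex_closure_def by blast
  then show "\<exists>B i j p q. is_biproduct C X Y B i j p q \<and> B \<in> Ex_closure C A"
    using bip by blast
  fix f assume "f \<in> Hom C X Y"
  from kernel_cokernel_Ex_iter[OF XY this]
  show "\<exists>k. is_kernel C k f \<and> Dom C k \<in> Ex_closure C A"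
    "\<exists>c. is_cokernel C c f \<and> Cod C c \<in> Ex_closure C A"
    unfolding Ex_closure_def by blast+
qed

end

theorem corollary5p7:
  fixes Z :: "('o, 'm, 'x) ab_cat_scheme" and A :: "'o set"
  assumes "abelian_category Z"
    and "full_abelian_subcategory Z A"
  shows "abelian_category (full_subcat Z (Ex_closure Z A))"
proof -
  interpret Z: abelian_category Z by fact
  interpret D: abelian_category "full_subcat Z A"
    using assms(2) by (simp add: full_abelian_subcategory_def)
  have A: "A \<subseteq> Obj Z"
    using assms(2) by (simp add: full_abelian_subcategory_def strictly_full_def)
  have "exact_full_subcategory Z A"
  proof
    show "\<exists>N\<in>A. null_object Z N"
      using D.ex_null_object A unfolding D.null_object_iff_Id Z.null_object_iff_Id by auto
  qed (use A Z.full_abelian_subcategory_closed[OF assms(2)] in blast)+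
  then show ?thesis by (rule exact_full_subcategory.abelian_Ex_closure)
qed

end
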